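(* Let $k$ be a field with $\operatorname{char} k\neq 2$ and let $A=Cl(\alpha,\beta_i,\gamma_i,\lambda_{ij})$ be a Clifford algebra over $k$, with associated symmetric matrix $Q$. Then $A$ is semisimple if and only if $\det Q\neq 0$.
   Context: Given a non-negative integer $n$ and scalars $\alpha,\beta_i,\gamma_i\in k$ ($1\le i\le n$) and $\lambda_{ij}\in k$ ($1\le i<j\le n$), $Cl(\alpha,\beta_i,\gamma_i,\lambda_{ij})$ is the unital associative $k$-algebra generated by $G,X_1,\ldots,X_n$ with relations $G^2=\alpha$, $X_i^2=\beta_i$, $GX_i+X_iG=\gamma_i$ for all $i$, and $X_iX_j+X_jX_i=\lambda_{ij}$ for $i<j$. It has dimension $2^{n+1}$. $Q$ is the symmetric $(n+1)\times(n+1)$ matrix over $k$, with rows and columns indexed by $0,1,\ldots,n$, with $Q_{00}=\alpha$, $Q_{ii}=\beta_i$ for $1\le i\le n$, $Q_{0i}=Q_{i0}=\gamma_i/2$ for $1\le i\le n$, and $Q_{ij}=Q_{ji}=\lambda_{ij}/2$ for $1\le i<j\le n$. *)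

theory Defs
  imports
    "HOL-Algebra.QuotRing"
    "HOL-Library.Poly_Mapping"
    "Jordan_Normal_Form.Determinant"
begin

section \<open>The free unital associative algebra on finitely many generators\<close>

text \<open>
  Words form a free monoid under concatenation, written additively so that the product of
  \<open>Poly_Mapping\<close> on \<open>word \<Rightarrow>\<^sub>0 'k\<close> is the (noncommutative) convolution product of the
  monoid algebra. The letter \<open>0\<close> stands for the generator \<open>G\<close>, the letter \<open>i\<close> with
  \<open>1 \<le> i \<le> n\<close> for \<open>X\<^sub>i\<close>.
\<close>

datatype word = Word (letters: "nat list")

instantiation word :: monoid_add
begin

definition zero_word :: word where
  "0 = Word []"

definition plus_word :: "word \<Rightarrow> word \<Rightarrow> word" where
  "u + v = Word (letters u @ letters v)"

instance
  by standard (simp_all add: zero_word_def plus_word_def)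

end

definition const :: "'k \<Rightarrow> word \<Rightarrow>\<^sub>0 'k::field" where
  "const c = Poly_Mapping.single 0 c"

definition gen :: "nat \<Rightarrow> word \<Rightarrow>\<^sub>0 'k::field" where
  "gen i = Poly_Mapping.single (Word [i]) 1"

definition free_algebra :: "nat \<Rightarrow> (word \<Rightarrow>\<^sub>0 'k::field) ring" where
  "free_algebra n =
    \<lparr>carrier = {p. \<forall>w \<in> Poly_Mapping.keys p. set (letters w) \<subseteq> {0..n}},
     monoid.mult = (*), one = 1, zero = 0, add = (+)\<rparr>"

lemma free_algebra_ring: "ring (free_algebra n :: (word \<Rightarrow>\<^sub>0 'k::field) ring)"
proof -
  let ?C = "{p :: word \<Rightarrow>\<^sub>0 'k. \<forall>w \<in> Poly_Mapping.keys p. set (letters w) \<subseteq> {0..n}}"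
  have add: "p + q \<in> ?C" if "p \<in> ?C" "q \<in> ?C" for p q
    using that Poly_Mapping.keys_add[of p q] by blast
  have uminus: "- p \<in> ?C" if "p \<in> ?C" for p
    using that by simp
  have mult: "p * q \<in> ?C" if "p \<in> ?C" "q \<in> ?C" for p q
  proof -
    have "set (letters w) \<subseteq> {0..n}" if w: "w \<in> Poly_Mapping.keys (p * q)" for w
    proof -
      obtain u v where "w = u + v" "u \<in> Poly_Mapping.keys p" "v \<in> Poly_Mapping.keys q"
        using w Poly_Mapping.keys_mult[of p q] by blast
      moreover from this have "set (letters u) \<subseteq> {0..n}" "set (letters v) \<subseteq> {0..n}"
        using \<open>p \<in> ?C\<close> \<open>q \<in> ?C\<close> by blast+
      ultimately show ?thesis by (auto simp: plus_word_def)
    qed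
    then show ?thesis by blast
  qed
  have one: "1 \<in> ?C"
    by (simp add: zero_word_def)
  let ?F = "free_algebra n :: (word \<Rightarrow>\<^sub>0 'k) ring"
  have carrier: "carrier ?F = ?C"
    by (simp add: free_algebra_def)
  have ops: "x \<otimes>\<^bsub>?F\<^esub> y = x * y" "x \<oplus>\<^bsub>?F\<^esub> y = x + y" "\<one>\<^bsub>?F\<^esub> = 1" "\<zero>\<^bsub>?F\<^esub> = 0" for x y
    by (simp_all add: free_algebra_def)
  have ag: "abelian_group ?F"
  proof (rule abelian_groupI, unfold carrier ops)
    show "\<exists>y \<in> ?C. y + x = 0" if "x \<in> ?C" for x
      by (rule bexI[OF _ uminus[OF that]]) (rule left_minus)
  qed ((rule add; assumption), simp, (rule add.assoc), (rule add.commute), (rule add_0_left))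
  have mon: "monoid ?F"
    by (rule monoidI, unfold carrier ops)
      ((rule mult; assumption), rule one, rule mult.assoc, rule mult_1_left, rule mult_1_right)
  show ?thesis
    by (rule ringI[OF ag mon], unfold ops) (rule distrib_right, rule distrib_left)
qed


section \<open>The Clifford algebra and its matrix\<close>

text \<open>
  The parameters are total functions; only \<open>\<beta> i\<close>, \<open>\<gamma> i\<close> for \<open>1 \<le> i \<le> n\<close> and
  \<open>\<lambda> i j\<close> for \<open>1 \<le> i < j \<le> n\<close> are used.
\<close>

definition clifford_relations ::
  "nat \<Rightarrow> 'k \<Rightarrow> (nat \<Rightarrow> 'k) \<Rightarrow> (nat \<Rightarrow> 'k) \<Rightarrow> (nat \<Rightarrow> nat \<Rightarrow> 'k) \<Rightarrow> (word \<Rightarrow>\<^sub>0 'k::field) set"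
where
  "clifford_relations n \<alpha> \<beta> \<gamma> lam =
    {gen 0 * gen 0 - const \<alpha>}
    \<union> {gen i * gen i - const (\<beta> i) | i. i \<in> {1..n}}
    \<union> {gen 0 * gen i + gen i * gen 0 - const (\<gamma> i) | i. i \<in> {1..n}}
    \<union> {gen i * gen j + gen j * gen i - const (lam i j) | i j. 1 \<le> i \<and> i < j \<and> j \<le> n}"

text \<open>
  HOL-Algebra ideals are two-sided also over noncommutative rings. Since the free algebra is unital
  and contains the scalars, ring ideals and algebra ideals coincide.
\<close>

definition clifford_algebra ::
  "nat \<Rightarrow> 'k \<Rightarrow> (nat \<Rightarrow> 'k) \<Rightarrow> (nat \<Rightarrow> 'k) \<Rightarrow> (nat \<Rightarrow> nat \<Rightarrow> 'k) \<Rightarrow> (word \<Rightarrow>\<^sub>0 'k::field) set ring"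
where
  "clifford_algebra n \<alpha> \<beta> \<gamma> lam =
    free_algebra n Quot (genideal (free_algebra n) (clifford_relations n \<alpha> \<beta> \<gamma> lam))"

lemma clifford_relations_subset:
  "clifford_relations n \<alpha> \<beta> \<gamma> lam \<subseteq> carrier (free_algebra n)"
proof -
  interpret ring "free_algebra n :: (word \<Rightarrow>\<^sub>0 'a) ring"
    by (rule free_algebra_ring)
  have const: "const c \<in> carrier (free_algebra n)" for c :: 'a
    by (simp add: const_def free_algebra_def zero_word_def)
  have gen: "(gen i :: word \<Rightarrow>\<^sub>0 'a) \<in> carrier (free_algebra n)" if "i \<le> n" for i
    using that by (simp add: gen_def free_algebra_def)
  have mult: "p * q \<in> carrier (free_algebra n)"
    if "p \<in> carrier (free_algebra n)" "q \<in> carrier (free_algebra n)" for p q :: "word \<Rightarrow>\<^sub>0 'a"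
    using m_closed[OF that] by (simp add: free_algebra_def)
  have add: "p + q \<in> carrier (free_algebra n)"
    if "p \<in> carrier (free_algebra n)" "q \<in> carrier (free_algebra n)" for p q :: "word \<Rightarrow>\<^sub>0 'a"
    using a_closed[OF that] by (simp add: free_algebra_def)
  have diff: "p - q \<in> carrier (free_algebra n)"
    if "p \<in> carrier (free_algebra n)" "q \<in> carrier (free_algebra n)" for p q :: "word \<Rightarrow>\<^sub>0 'a"
  proof -
    have "- q \<in> carrier (free_algebra n)"
      using that(2) by (simp add: free_algebra_def)
    then show ?thesis
      using add[OF that(1)] unfolding diff_conv_add_uminus by blast
  qed
  have rel: "gen i * gen j - const c \<in> carrier (free_algebra n)"
      "gen i * gen j + gen j * gen i - const c \<in> carrier (free_algebra n)"
    if "i \<le> n" "j \<le> n" for i j and c :: 'a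
    by (intro diff add mult gen const that)+
  show ?thesis
    unfolding clifford_relations_def
  proof (intro Un_least subsetI; (elim singletonE CollectE exE conjE)?)
    fix p :: "word \<Rightarrow>\<^sub>0 'a" and i
    assume i: "i \<in> {1..n}"
    then have le: "i \<le> n" by simp
    show "p \<in> carrier (free_algebra n)" if "p = gen i * gen i - const (\<beta> i)"
      unfolding that by (rule rel(1)[OF le le])
    show "p \<in> carrier (free_algebra n)" if "p = gen 0 * gen i + gen i * gen 0 - const (\<gamma> i)"
      unfolding that by (rule rel(2)[OF le0 le])
  next
    fix p :: "word \<Rightarrow>\<^sub>0 'a" and i j
    assume "1 \<le> i" "i < j" and j: "j \<le> n"
    then have i: "i \<le> n" by linarith
    show "p \<in> carrier (free_algebra n)" if "p = gen i * gen j + gen j * gen i - const (lam i j)"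
      unfolding that by (rule rel(2)[OF i j])
  next
    fix p :: "word \<Rightarrow>\<^sub>0 'a"
    show "p \<in> carrier (free_algebra n)" if "p = gen 0 * gen 0 - const \<alpha>"
      unfolding that by (rule rel(1)[OF le0 le0])
  qed
qed

lemma clifford_algebra_ring: "ring (clifford_algebra n \<alpha> \<beta> \<gamma> lam)"
  unfolding clifford_algebra_def
  by (intro ideal.quotient_is_ring ring.genideal_ideal free_algebra_ring clifford_relations_subset)

definition clifford_matrix ::
  "nat \<Rightarrow> 'k \<Rightarrow> (nat \<Rightarrow> 'k) \<Rightarrow> (nat \<Rightarrow> 'k) \<Rightarrow> (nat \<Rightarrow> nat \<Rightarrow> 'k) \<Rightarrow> 'k::field mat"
where
  "clifford_matrix n \<alpha> \<beta> \<gamma> lam =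
    mat (n + 1) (n + 1) (\<lambda>(i, j).
      if i = 0 \<and> j = 0 then \<alpha>
      else if i = 0 then \<gamma> j / 2
      else if j = 0 then \<gamma> i / 2
      else if i = j then \<beta> i
      else if i < j then lam i j / 2
      else lam j i / 2)"


section \<open>Semisimple rings\<close>

definition left_ideal :: "('a, 'b) ring_scheme \<Rightarrow> 'a set \<Rightarrow> bool" where
  "left_ideal R I \<longleftrightarrow>
    additive_subgroup I R \<and> (\<forall>a \<in> carrier R. \<forall>x \<in> I. a \<otimes>\<^bsub>R\<^esub> x \<in> I)"

definition left_ideal_generated :: "('a, 'b) ring_scheme \<Rightarrow> 'a set \<Rightarrow> 'a set" where
  "left_ideal_generated R H = \<Inter>{I. left_ideal R I \<and> H \<subseteq> I}"

text \<open>The left ideals of \<open>R\<close> are the submodules of the left regular module.\<close>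

definition simple_left_ideal :: "('a, 'b) ring_scheme \<Rightarrow> 'a set \<Rightarrow> bool" where
  "simple_left_ideal R I \<longleftrightarrow>
    left_ideal R I \<and> I \<noteq> {\<zero>\<^bsub>R\<^esub>} \<and>
    (\<forall>J. left_ideal R J \<and> J \<subseteq> I \<longrightarrow> J = {\<zero>\<^bsub>R\<^esub>} \<or> J = I)"

text \<open>
  \<open>R\<close> is semisimple if its left regular module is the internal direct sum of a family of simple
  submodules. The sum of a family of submodules is the submodule generated by their union, and the
  sum is direct if every member meets the sum of the others trivially.
\<close>

definition semisimple_ring :: "('a, 'b) ring_scheme \<Rightarrow> bool" where
  "semisimple_ring R \<longleftrightarrow>
    (\<exists>S. (\<forall>I \<in> S. simple_left_ideal R I) \<and>
      (\<forall>I \<in> S. I \<inter> left_ideal_generated R (\<Union>(S - {I})) = {\<zero>\<^bsub>R\<^esub>}) \<and>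
      left_ideal_generated R (\<Union>S) = carrier R)"

end

theory Submission
  imports Defs
begin

text \<open>
  Let \<open>F\<close> be the free algebra, \<open>K\<close> the ideal of the Clifford relations and \<open>V\<close> the span of the
  generators. The relations say that \<open>x y + y x = 2 Q(x, y)\<close> modulo \<open>K\<close> for \<open>x, y \<in> V\<close>, where \<open>Q\<close> also
  denotes the symmetric bilinear form of the matrix. All calculations take place in \<open>F\<close> modulo \<open>K\<close>;
  left ideals of the Clifford algebra are left ideals of \<open>F\<close> that contain \<open>K\<close>.

  Suppose \<open>det Q \<noteq> 0\<close>. Since \<open>2 \<noteq> 0\<close>, the space \<open>V\<close> has an orthogonal basis, so the algebra is generated
  by anticommuting elements \<open>e\<close> whose squares are nonzero scalars. These behave like the elements of
  a finite group of invertible order: as in Maschke's theorem, a linear projection onto a left ideal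
  can be averaged over \<open>1\<close> and \<open>e\<close> for one \<open>e\<close> after the other until it commutes with the whole algebra
  (\<open>equivariant_projection\<close>). Its kernel is a complementary left ideal. Sorted products of generators
  span the algebra, so it has finite dimension, and complements together with finite length make
  the regular module a direct sum of simple ones (\<open>complemented_imp_direct_sum_of_simple\<close>).

  Suppose \<open>det Q = 0\<close>, and let \<open>v \<noteq> 0\<close> be in the kernel of \<open>Q\<close>. The element \<open>x = \<Sum>\<^sub>j v\<^sub>j e\<^sub>j\<close> anticommutes
  with all generators and squares to zero, so it generates an ideal of square zero, and a semisimple
  ring has none but zero (\<open>semisimple_imp_no_square_zero\<close>). It remains to see that \<open>x \<notin> K\<close>, that
  is, that the relations do not force the generators to become linearly dependent. For this the
  Clifford algebra is made to act on the exterior algebra by creation and annihilation operators;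
  applied to the vacuum, \<open>x\<close> gives \<open>v\<close> back (\<open>independent_gens_mod_rep_kernel\<close>).
\<close>

section \<open>Left ideals and semisimplicity\<close>

context ring
begin

lemma left_idealI:
  assumes "I \<subseteq> carrier R" "\<zero> \<in> I" "\<And>x y. x \<in> I \<Longrightarrow> y \<in> I \<Longrightarrow> x \<oplus> y \<in> I"
    and smult: "\<And>a x. a \<in> carrier R \<Longrightarrow> x \<in> I \<Longrightarrow> a \<otimes> x \<in> I"
  shows "left_ideal R I"
proof -
  have "\<ominus> x \<in> I" if "x \<in> I" for x
  proof -
    have "\<ominus> x = (\<ominus> \<one>) \<otimes> x"
      using that assms(1) l_minus[OF one_closed, of x] by auto
    then show ?thesis using smult[of "\<ominus> \<one>" x] that by simp
  qed
  then have "additive_subgroup I R"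
    using assms by unfold_locales (auto simp: a_inv_def)
  then show ?thesis using smult unfolding left_ideal_def by blast
qed

lemma left_ideal_facts:
  assumes "left_ideal R I"
  shows left_ideal_subset: "I \<subseteq> carrier R"
    and left_ideal_zero: "\<zero> \<in> I"
    and left_ideal_add: "\<And>x y. x \<in> I \<Longrightarrow> y \<in> I \<Longrightarrow> x \<oplus> y \<in> I"
    and left_ideal_smult: "\<And>a x. a \<in> carrier R \<Longrightarrow> x \<in> I \<Longrightarrow> a \<otimes> x \<in> I"
proof -
  have I: "additive_subgroup I R" "\<forall>a \<in> carrier R. \<forall>x \<in> I. a \<otimes> x \<in> I"
    using assms by (simp_all add: left_ideal_def)
  show "I \<subseteq> carrier R" by (rule additive_subgroup.a_subset[OF I(1)])
  show "\<zero> \<in> I" by (rule additive_subgroup.zero_closed[OF I(1)])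
  show "x \<oplus> y \<in> I" if "x \<in> I" "y \<in> I" for x y
    using that by (rule additive_subgroup.a_closed[OF I(1)])
  show "a \<otimes> x \<in> I" if "a \<in> carrier R" "x \<in> I" for a x
    using I(2) that by blast
qed

lemma left_ideal_minus:
  assumes "left_ideal R I" "x \<in> I" "y \<in> I"
  shows "x \<ominus> y \<in> I"
proof -
  have "additive_subgroup I R" using assms(1) by (simp add: left_ideal_def)
  then have "\<ominus> y \<in> I" using assms(3) by (rule additive_subgroup.a_inv_closed)
  then show ?thesis using left_ideal_add[OF assms(1) assms(2)] by (simp add: a_minus_def)
qed

lemma left_ideal_zero_set: "left_ideal R {\<zero>}"
  by (rule left_idealI) auto

lemma left_ideal_carrier: "left_ideal R (carrier R)"
  by (rule left_idealI) auto

lemma left_ideal_Int: "left_ideal R I \<Longrightarrow> left_ideal R J \<Longrightarrow> left_ideal R (I \<inter> J)"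
  by (rule left_idealI) (simp_all add: left_ideal_facts le_infI1)

lemma left_ideal_sum:
  assumes I: "left_ideal R I" and J: "left_ideal R J"
  shows "left_ideal R {x \<oplus> y | x y. x \<in> I \<and> y \<in> J}"
proof (rule left_idealI)
  note fI = left_ideal_facts[OF I] and fJ = left_ideal_facts[OF J]
  show "{x \<oplus> y | x y. x \<in> I \<and> y \<in> J} \<subseteq> carrier R" using fI(1) fJ(1) by auto
  show "\<zero> \<in> {x \<oplus> y | x y. x \<in> I \<and> y \<in> J}" using fI(2) fJ(2) by force
  show "u \<oplus> v \<in> {x \<oplus> y | x y. x \<in> I \<and> y \<in> J}"
    if uv: "u \<in> {x \<oplus> y | x y. x \<in> I \<and> y \<in> J}" "v \<in> {x \<oplus> y | x y. x \<in> I \<and> y \<in> J}" for u v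
  proof -
    obtain a b a' b' where *: "u = a \<oplus> b" "v = a' \<oplus> b'" "a \<in> I" "b \<in> J" "a' \<in> I" "b' \<in> J"
      using uv by blast
    have "u \<oplus> v = (a \<oplus> a') \<oplus> (b \<oplus> b')"
      unfolding * using * fI(1) fJ(1) by (simp add: a_ac subset_iff)
    then show ?thesis using * fI(3) fJ(3) by blast
  qed
  show "a \<otimes> u \<in> {x \<oplus> y | x y. x \<in> I \<and> y \<in> J}"
    if u: "a \<in> carrier R" "u \<in> {x \<oplus> y | x y. x \<in> I \<and> y \<in> J}" for a u
  proof -
    obtain x y where *: "u = x \<oplus> y" "x \<in> I" "y \<in> J" using u by blast
    have "a \<otimes> u = a \<otimes> x \<oplus> a \<otimes> y"
      unfolding * using * u(1) fI(1) fJ(1) by (simp add: r_distr subset_iff)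
    then show ?thesis using * u(1) fI(4) fJ(4) by blast
  qed
qed

lemma left_ideal_generated_least:
  "left_ideal R I \<Longrightarrow> H \<subseteq> I \<Longrightarrow> left_ideal_generated R H \<subseteq> I"
  unfolding left_ideal_generated_def by blast

lemma left_ideal_generated_superset: "H \<subseteq> left_ideal_generated R H"
  unfolding left_ideal_generated_def by blast

lemma left_ideal_generated_mono:
  "H \<subseteq> H' \<Longrightarrow> left_ideal_generated R H \<subseteq> left_ideal_generated R H'"
  unfolding left_ideal_generated_def by blast

lemma left_ideal_generated:
  assumes "H \<subseteq> carrier R"
  shows "left_ideal R (left_ideal_generated R H)"
proof (rule left_idealI)
  show "left_ideal_generated R H \<subseteq> carrier R"
    by (rule left_ideal_generated_least[OF left_ideal_carrier assms])
qed (simp_all add: left_ideal_generated_def left_ideal_facts)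

text \<open>
  The classical implication from ``every submodule is a direct summand'' to ``direct sum of
  simples'', by induction on the length of a left ideal; the hypothesis on \<open>d\<close> only says that the
  length is finite. A nonzero \<open>L\<close> contains a nonzero left ideal \<open>I\<close> of least \<open>d\<close>, which is simple;
  by the modular law \<open>L\<close> is the direct sum of \<open>I\<close> and \<open>C \<inter> L\<close> for any complement \<open>C\<close> of \<open>I\<close>.
\<close>

lemma complemented_imp_direct_sum_of_simple:
  fixes d :: "'a set \<Rightarrow> nat"
  assumes compl: "\<And>I. left_ideal R I \<Longrightarrow> \<exists>C. left_ideal R C \<and> I \<inter> C = {\<zero>} \<and>
      (\<forall>x \<in> carrier R. \<exists>a \<in> I. \<exists>b \<in> C. x = a \<oplus> b)"
    and d: "\<And>I J. left_ideal R I \<Longrightarrow> left_ideal R J \<Longrightarrow> I \<subset> J \<Longrightarrow> d I < d J"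
    and L: "left_ideal R L"
  shows "\<exists>S. (\<forall>I \<in> S. simple_left_ideal R I) \<and>
      (\<forall>I \<in> S. I \<inter> left_ideal_generated R (\<Union>(S - {I})) = {\<zero>}) \<and>
      left_ideal_generated R (\<Union>S) = L"
  using L
proof (induction "d L" arbitrary: L rule: less_induct)
  case less
  note L = \<open>left_ideal R L\<close>
  show ?case
  proof (cases "L = {\<zero>}")
    case True
    have "left_ideal_generated R {} = {\<zero>}"
      using left_ideal_generated_least[OF left_ideal_zero_set, of "{}"]
        left_ideal_zero[OF left_ideal_generated[of "{}"]] by auto
    with True show ?thesis by (intro exI[of _ "{}"]) simp
  next
    case False
    let ?P = "\<lambda>I. left_ideal R I \<and> I \<subseteq> L \<and> I \<noteq> {\<zero>}"
    define I where "I = arg_min d ?P"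
    have "?P L" using L False by simp
    then have PI: "?P I" and min: "\<And>J. ?P J \<Longrightarrow> d I \<le> d J"
      unfolding I_def using arg_min_nat_lemma[of ?P L d] by blast+
    have I: "left_ideal R I" "I \<subseteq> L" "I \<noteq> {\<zero>}" using PI by auto
    have "J = {\<zero>} \<or> J = I" if "left_ideal R J" "J \<subseteq> I" for J
      using min[of J] d[OF that(1) I(1)] that I by fastforce
    then have simple: "simple_left_ideal R I"
      using I unfolding simple_left_ideal_def by blast
    obtain C where C: "left_ideal R C" "I \<inter> C = {\<zero>}"
        "\<forall>x \<in> carrier R. \<exists>a \<in> I. \<exists>b \<in> C. x = a \<oplus> b"
      using compl[OF I(1)] by blast
    define D where "D = C \<inter> L"
    have D: "left_ideal R D" unfolding D_def by (rule left_ideal_Int[OF C(1) L])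
    have ID: "I \<inter> D = {\<zero>}"
      using C(2) left_ideal_zero[OF D] left_ideal_zero[OF I(1)] by (auto simp: D_def)
    have L_split: "\<exists>a \<in> I. \<exists>b \<in> D. x = a \<oplus> b" if x: "x \<in> L" for x
    proof -
      have "x \<in> carrier R" using x left_ideal_subset[OF L] by blast
      then obtain a b where ab: "a \<in> I" "b \<in> C" "x = a \<oplus> b" using C(3) by blast
      then have car: "a \<in> carrier R" "b \<in> carrier R"
        using left_ideal_subset[OF I(1)] left_ideal_subset[OF C(1)] by auto
      have "b = x \<ominus> a" unfolding ab(3) using car by algebra
      then have "b \<in> L" using left_ideal_minus[OF L x] ab(1) I(2) by auto
      with ab show ?thesis unfolding D_def by blast
    qed
    have "D \<noteq> L"
      using I(2,3) ID left_ideal_zero[OF I(1)] by blast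
    then have "D \<subset> L" unfolding D_def by blast
    from d[OF D L this] obtain S where S: "\<forall>J \<in> S. simple_left_ideal R J"
        "\<forall>J \<in> S. J \<inter> left_ideal_generated R (\<Union>(S - {J})) = {\<zero>}"
        "left_ideal_generated R (\<Union>S) = D"
      using less.hyps[OF _ D] by blast
    have SD: "\<Union>S \<subseteq> D" using left_ideal_generated_superset[of "\<Union>S"] S(3) by simp
    then have S_car: "\<Union>S \<subseteq> carrier R" using left_ideal_subset[OF D] by blast
    let ?S = "insert I S"
    have S'_car: "\<Union>?S \<subseteq> carrier R" using S_car left_ideal_subset[OF I(1)] by simp
    have "I \<notin> S"
    proof
      assume "I \<in> S"
      then have "I \<subseteq> D" using SD by blast
      then show False using ID I(3) by blast
    qed
    have gen_eq: "left_ideal_generated R (\<Union>?S) = L"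
    proof
      show "left_ideal_generated R (\<Union>?S) \<subseteq> L"
        by (rule left_ideal_generated_least[OF L]) (use SD I(2) in \<open>auto simp: D_def\<close>)
      show "L \<subseteq> left_ideal_generated R (\<Union>?S)"
      proof
        fix x assume "x \<in> L"
        then obtain a b where ab: "a \<in> I" "b \<in> D" "x = a \<oplus> b" using L_split by blast
        have "a \<in> left_ideal_generated R (\<Union>?S)"
          using ab(1) left_ideal_generated_superset[of "\<Union>?S"] by auto
        moreover have "b \<in> left_ideal_generated R (\<Union>?S)"
          using ab(2) S(3) left_ideal_generated_mono[of "\<Union>S" "\<Union>?S"] by auto
        ultimately show "x \<in> left_ideal_generated R (\<Union>?S)"
          unfolding ab(3) by (rule left_ideal_add[OF left_ideal_generated[OF S'_car]])
      qed
    qed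
    have indep: "J \<inter> left_ideal_generated R (\<Union>(?S - {J})) = {\<zero>}" if J: "J \<in> ?S" for J
    proof (cases "J = I")
      case True
      have "?S - {J} = S" using True \<open>I \<notin> S\<close> by auto
      then show ?thesis using True S(3) ID by simp
    next
      case False
      then have JS: "J \<in> S" using J by blast
      let ?G = "left_ideal_generated R (\<Union>(S - {J}))"
      have G: "left_ideal R ?G" by (rule left_ideal_generated) (use S_car in auto)
      have GD: "?G \<subseteq> D" using S(3) left_ideal_generated_mono[of "\<Union>(S - {J})" "\<Union>S"] by auto
      have JD: "J \<subseteq> D" using JS SD by blast
      have J_ideal: "left_ideal R J" using S(1) JS by (simp add: simple_left_ideal_def)
      have "left_ideal_generated R (\<Union>(?S - {J})) \<subseteq> {x \<oplus> y | x y. x \<in> I \<and> y \<in> ?G}"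
      proof (rule left_ideal_generated_least[OF left_ideal_sum[OF I(1) G]], rule subsetI)
        fix z assume "z \<in> \<Union>(?S - {J})"
        then consider "z \<in> I" | "z \<in> \<Union>(S - {J})" by blast
        then show "z \<in> {x \<oplus> y | x y. x \<in> I \<and> y \<in> ?G}"
        proof cases
          case 1
          then have "z = z \<oplus> \<zero>" using left_ideal_subset[OF I(1)] by auto
          then show ?thesis using 1 left_ideal_zero[OF G] by blast
        next
          case 2
          then have z: "z \<in> ?G" by (rule subsetD[OF left_ideal_generated_superset])
          then have "z = \<zero> \<oplus> z" using left_ideal_subset[OF G] by auto
          then show ?thesis using z left_ideal_zero[OF I(1)] by blast
        qed
      qed
      moreover have "z = \<zero>" if z: "z \<in> J" "z = x \<oplus> y" "x \<in> I" "y \<in> ?G" for x y z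
      proof -
        have car: "x \<in> carrier R" "y \<in> carrier R"
          using z left_ideal_subset[OF I(1)] left_ideal_subset[OF G] by auto
        have "x = z \<ominus> y" unfolding z(2) using car by algebra
        then have "x \<in> D" using left_ideal_minus[OF D] z JD GD by blast
        then have "x = \<zero>" using z(3) ID by blast
        then have "z = y" using z(2) car by simp
        then show ?thesis using z(1,4) S(2) JS by blast
      qed
      ultimately have "J \<inter> left_ideal_generated R (\<Union>(?S - {J})) \<subseteq> {\<zero>}" by blast
      moreover have "left_ideal R (left_ideal_generated R (\<Union>(?S - {J})))"
        by (rule left_ideal_generated) (use S'_car in auto)
      ultimately show ?thesis
        using left_ideal_zero J_ideal by blast
    qed
    show ?thesis
      by (rule exI[of _ ?S]) (use simple S(1) indep gen_eq in auto)
  qed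
qed

text \<open>
  The hypotheses say that \<open>Rx\<close> is a two-sided ideal of square zero. For simple \<open>I\<close> the elements of
  \<open>I\<close> killed by \<open>x\<close> form a left ideal, which contains \<open>xI\<close> and hence is nonzero unless \<open>xI = 0\<close>
  anyway; so \<open>x\<close> kills every simple left ideal, hence their sum, hence \<open>\<one>\<close>.
\<close>

lemma semisimple_imp_no_square_zero:
  assumes ss: "semisimple_ring R"
    and x: "x \<in> carrier R" "x \<otimes> x = \<zero>"
    and normal: "\<And>a. a \<in> carrier R \<Longrightarrow> \<exists>a' \<in> carrier R. x \<otimes> a = a' \<otimes> x"
  shows "x = \<zero>"
proof -
  define N where "N = {z \<in> carrier R. x \<otimes> z = \<zero>}"
  have N: "left_ideal R N"
  proof (rule left_idealI)
    fix a z assume a: "a \<in> carrier R" and z: "z \<in> N"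
    obtain a' where a': "a' \<in> carrier R" "x \<otimes> a = a' \<otimes> x" using normal[OF a] by blast
    have z': "z \<in> carrier R" using z by (simp add: N_def)
    have "x \<otimes> (a \<otimes> z) = (x \<otimes> a) \<otimes> z" using x(1) a z' by (simp add: m_assoc)
    also have "\<dots> = a' \<otimes> (x \<otimes> z)" unfolding a'(2) using x(1) a'(1) z' by (simp add: m_assoc)
    finally have "x \<otimes> (a \<otimes> z) = a' \<otimes> (x \<otimes> z)" .
    then show "a \<otimes> z \<in> N" using a a' z by (simp add: N_def)
  qed (use x in \<open>auto simp: N_def r_distr\<close>)
  obtain S where S: "\<forall>I \<in> S. simple_left_ideal R I" "left_ideal_generated R (\<Union>S) = carrier R"
    using ss unfolding semisimple_ring_def by blast
  have "I \<subseteq> N" if "I \<in> S" for I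
  proof -
    have I: "left_ideal R I" and simple: "\<And>J. left_ideal R J \<Longrightarrow> J \<subseteq> I \<Longrightarrow> J = {\<zero>} \<or> J = I"
      using S(1) that unfolding simple_left_ideal_def by blast+
    have I_car: "I \<subseteq> carrier R" by (rule left_ideal_subset[OF I])
    have xI: "x \<otimes> y \<in> I \<inter> N" if "y \<in> I" for y
      using left_ideal_smult[OF I x(1) that] that I_car x m_assoc[of x x y, symmetric]
      by (auto simp: N_def)
    from simple[OF left_ideal_Int[OF I N]] consider "I \<inter> N = {\<zero>}" | "I \<inter> N = I" by blast
    then show ?thesis
    proof cases
      case 1
      then show ?thesis using xI I_car by (auto simp: N_def)
    qed blast
  qed
  then have "\<Union>S \<subseteq> N" by blast
  from left_ideal_generated_least[OF N this] have "\<one> \<in> N" using S(2) by blast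
  then show ?thesis using x by (simp add: N_def)
qed

end

text \<open>
  Left ideals of \<open>R Quot I\<close> are the images of the left ideals of \<open>R\<close> that contain \<open>I\<close>, so both
  criteria can be applied to a quotient by computing in \<open>R\<close> modulo \<open>I\<close>.
\<close>

context ideal
begin

lemma coset_eq_iff:
  "p \<in> carrier R \<Longrightarrow> q \<in> carrier R \<Longrightarrow> I +> p = I +> q \<longleftrightarrow> p \<ominus> q \<in> I"
proof -
  assume pq: "p \<in> carrier R" "q \<in> carrier R"
  have "I +> p = I +> q" if "p \<in> I +> q"
    using a_repr_independence[OF that pq(2) a_subgroup] by simp
  then show ?thesis
    using a_rcos_module_minus[OF ring_axioms pq(2,1)] a_rcos_self[OF pq(1)] by auto
qed

lemma quotient_ring_facts:
  shows carrier_quotient: "carrier (R Quot I) = (\<lambda>p. I +> p) ` carrier R"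
    and coset_add: "p \<in> carrier R \<Longrightarrow> q \<in> carrier R \<Longrightarrow>
        (I +> p) \<oplus>\<^bsub>R Quot I\<^esub> (I +> q) = I +> (p \<oplus> q)"
    and coset_mult: "p \<in> carrier R \<Longrightarrow> q \<in> carrier R \<Longrightarrow>
        (I +> p) \<otimes>\<^bsub>R Quot I\<^esub> (I +> q) = I +> (p \<otimes> q)"
    and coset_zero: "\<zero>\<^bsub>R Quot I\<^esub> = I +> \<zero>"
  using a_coset_add_zero[of I] a_subset
  by (auto simp: FactRing_def A_RCOSETS_def' rcoset_mult_add a_rcos_sum)

lemma coset_eq_zero_iff:
  "p \<in> carrier R \<Longrightarrow> I +> p = \<zero>\<^bsub>R Quot I\<^esub> \<longleftrightarrow> p \<in> I"
  unfolding coset_zero by (subst coset_eq_iff) (auto simp: a_minus_def)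

lemma semisimple_quotientI:
  fixes d :: "'a set \<Rightarrow> nat"
  assumes compl: "\<And>L. left_ideal R L \<Longrightarrow> I \<subseteq> L \<Longrightarrow>
      \<exists>C. left_ideal R C \<and> L \<inter> C = I \<and> (\<forall>x \<in> carrier R. \<exists>a \<in> L. \<exists>b \<in> C. x = a \<oplus> b)"
    and d: "\<And>L M. left_ideal R L \<Longrightarrow> left_ideal R M \<Longrightarrow> I \<subseteq> L \<Longrightarrow> L \<subset> M \<Longrightarrow> d L < d M"
  shows "semisimple_ring (R Quot I)"
proof -
  interpret Q: ring "R Quot I" by (rule quotient_is_ring)
  define V where "V L = {p \<in> carrier R. I +> p \<in> L}" for L
  have V: "left_ideal R (V L)" and IV: "I \<subseteq> V L" and V_image: "L = (\<lambda>p. I +> p) ` V L"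
    if L: "left_ideal (R Quot I) L" for L
  proof -
    note fL = Q.left_ideal_facts[OF L]
    show "left_ideal R (V L)"
      by (rule left_idealI)
        (use fL in \<open>auto simp: V_def carrier_quotient coset_add[symmetric] coset_mult[symmetric]
          coset_zero[symmetric]\<close>)
    show "I \<subseteq> V L"
    proof
      fix p assume "p \<in> I"
      then have "p \<in> carrier R" "I +> p = \<zero>\<^bsub>R Quot I\<^esub>"
        using a_subset coset_eq_zero_iff[of p] by auto
      then show "p \<in> V L" using fL(2) by (simp add: V_def)
    qed
    show "L = (\<lambda>p. I +> p) ` V L"
      using fL(1) by (auto simp: V_def carrier_quotient)
  qed
  have compl': "\<exists>C. left_ideal (R Quot I) C \<and> L \<inter> C = {\<zero>\<^bsub>R Quot I\<^esub>} \<and>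
      (\<forall>x \<in> carrier (R Quot I). \<exists>a \<in> L. \<exists>b \<in> C. x = a \<oplus>\<^bsub>R Quot I\<^esub> b)"
    if L: "left_ideal (R Quot I) L" for L
  proof -
    obtain C where C: "left_ideal R C" "V L \<inter> C = I"
        "\<forall>x \<in> carrier R. \<exists>a \<in> V L. \<exists>b \<in> C. x = a \<oplus> b"
      using compl[OF V[OF L] IV[OF L]] by blast
    note fC = left_ideal_facts[OF C(1)] and fL = Q.left_ideal_facts[OF L]
    let ?C = "(\<lambda>p. I +> p) ` C"
    have C1: "left_ideal (R Quot I) ?C"
    proof (rule Q.left_idealI)
      show "?C \<subseteq> carrier (R Quot I)" using fC(1) by (auto simp: carrier_quotient)
      show "\<zero>\<^bsub>R Quot I\<^esub> \<in> ?C" using fC(2) by (auto simp: coset_zero)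
      show "x \<oplus>\<^bsub>R Quot I\<^esub> y \<in> ?C" if xy: "x \<in> ?C" "y \<in> ?C" for x y
      proof -
        obtain p q where pq: "p \<in> C" "q \<in> C" "x = I +> p" "y = I +> q" using xy by blast
        then have "x \<oplus>\<^bsub>R Quot I\<^esub> y = I +> (p \<oplus> q)" using coset_add fC(1) by blast
        then show ?thesis using fC(3) pq by blast
      qed
      show "x \<otimes>\<^bsub>R Quot I\<^esub> y \<in> ?C" if xy: "x \<in> carrier (R Quot I)" "y \<in> ?C" for x y
      proof -
        obtain p q where pq: "p \<in> carrier R" "q \<in> C" "x = I +> p" "y = I +> q"
          using xy unfolding carrier_quotient by blast
        then have "x \<otimes>\<^bsub>R Quot I\<^esub> y = I +> (p \<otimes> q)" using coset_mult fC(1) by blast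
        then show ?thesis using fC(4) pq by blast
      qed
    qed
    have C2: "L \<inter> ?C = {\<zero>\<^bsub>R Quot I\<^esub>}"
    proof -
      have "z = \<zero>\<^bsub>R Quot I\<^esub>" if z: "z \<in> L" "z = I +> p" "p \<in> C" for z p
      proof -
        have p: "p \<in> carrier R" using z(3) fC(1) by blast
        then have "p \<in> V L" using z unfolding V_def by blast
        then show ?thesis using z coset_eq_zero_iff[OF p] C(2) by blast
      qed
      moreover have "\<zero>\<^bsub>R Quot I\<^esub> \<in> ?C" using fC(2) by (auto simp: coset_zero)
      ultimately show ?thesis using fL(2) by blast
    qed
    have C3: "\<exists>a \<in> L. \<exists>b \<in> ?C. x = a \<oplus>\<^bsub>R Quot I\<^esub> b"
      if x: "x \<in> carrier (R Quot I)" for x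
    proof -
      obtain p where p: "p \<in> carrier R" "x = I +> p" using x unfolding carrier_quotient by blast
      obtain a b where ab: "a \<in> V L" "b \<in> C" "p = a \<oplus> b" using C(3) p(1) by blast
      have "x = (I +> a) \<oplus>\<^bsub>R Quot I\<^esub> (I +> b)"
        unfolding p(2) ab(3) using ab fC(1) by (subst coset_add) (auto simp: V_def)
      moreover have "I +> a \<in> L" using ab(1) by (simp add: V_def)
      moreover have "I +> b \<in> ?C" using ab(2) by (rule imageI)
      ultimately show ?thesis by blast
    qed
    show ?thesis using C1 C2 C3 by (intro exI[of _ ?C] conjI ballI)
  qed
  have d': "d (V L) < d (V M)"
    if L: "left_ideal (R Quot I) L" and M: "left_ideal (R Quot I) M" and "L \<subset> M" for L M
  proof (rule d[OF V[OF L] V[OF M] IV[OF L]])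
    have "V L \<subseteq> V M" using \<open>L \<subset> M\<close> unfolding V_def by blast
    moreover have "V L \<noteq> V M" using V_image[OF L] V_image[OF M] \<open>L \<subset> M\<close> by auto
    ultimately show "V L \<subset> V M" by blast
  qed
  show ?thesis
    unfolding semisimple_ring_def
    by (rule Q.complemented_imp_direct_sum_of_simple[of "\<lambda>L. d (V L)", OF compl' d'
          Q.left_ideal_carrier])
qed

lemma semisimple_quotient_imp_no_square_zero:
  assumes ss: "semisimple_ring (R Quot I)"
    and x: "x \<in> carrier R" "x \<otimes> x \<in> I"
    and normal: "\<And>a. a \<in> carrier R \<Longrightarrow> \<exists>a' \<in> carrier R. x \<otimes> a \<ominus> a' \<otimes> x \<in> I"
  shows "x \<in> I"
proof -
  interpret Q: ring "R Quot I" by (rule quotient_is_ring)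
  have "I +> x = \<zero>\<^bsub>R Quot I\<^esub>"
  proof (rule Q.semisimple_imp_no_square_zero[OF ss])
    show "I +> x \<in> carrier (R Quot I)" using x(1) by (simp add: carrier_quotient)
    show "(I +> x) \<otimes>\<^bsub>R Quot I\<^esub> (I +> x) = \<zero>\<^bsub>R Quot I\<^esub>"
      using x by (simp add: coset_mult coset_eq_zero_iff)
    fix A assume "A \<in> carrier (R Quot I)"
    then obtain a where a: "a \<in> carrier R" "A = I +> a" unfolding carrier_quotient by blast
    then obtain a' where a': "a' \<in> carrier R" "x \<otimes> a \<ominus> a' \<otimes> x \<in> I" using normal by blast
    then have "(I +> x) \<otimes>\<^bsub>R Quot I\<^esub> A = (I +> a') \<otimes>\<^bsub>R Quot I\<^esub> (I +> x)"
      using a x(1) by (simp add: coset_mult coset_eq_iff)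
    then show "\<exists>A' \<in> carrier (R Quot I). (I +> x) \<otimes>\<^bsub>R Quot I\<^esub> A = A' \<otimes>\<^bsub>R Quot I\<^esub> (I +> x)"
      using a'(1) unfolding carrier_quotient by blast
  qed
  then show ?thesis using coset_eq_zero_iff[OF x(1)] by blast
qed

end

section \<open>Orthogonal bases and dimension\<close>

context vector_space
begin

lemma dim_strict_mono:
  assumes B: "finite B" and U: "subspace U" and UV: "U \<subset> V" and V: "V \<subseteq> span B"
  shows "dim U < dim V"
proof -
  obtain A where A: "A \<subseteq> U" "independent A" "U \<subseteq> span A" "card A = dim U"
    using basis_exists[of U] by blast
  obtain x where x: "x \<in> V" "x \<notin> U" using UV by blast
  have "span A \<subseteq> U" by (rule span_minimal[OF A(1) U])
  then have xA: "x \<notin> span A" using x(2) by blast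
  have "independent (insert x A)" by (rule independent_insertI[OF xA A(2)])
  moreover have "insert x A \<subseteq> V" using A(1) UV x(1) by blast
  ultimately obtain A' where A': "insert x A \<subseteq> A'" "A' \<subseteq> V" "independent A'" "V \<subseteq> span A'"
    using maximal_independent_subset_extend[of "insert x A" V] by blast
  have "finite A'" using independent_span_bound[OF B A'(3)] A'(2) V by blast
  moreover have "A \<subset> A'" using A'(1) xA span_base[of x A] by blast
  ultimately have "card A < card A'" by (rule psubset_card_mono)
  then show ?thesis using A(4) basis_card_eq_dim[OF A'(2,4,3)] by simp
qed

text \<open>
  Anisotropic orthogonal sets are independent, so there is one, \<open>S\<close>, of maximal size. By maximality
  the form vanishes on the diagonal of the orthogonal complement of \<open>S\<close>, hence by polarisation
  (\<open>2 \<noteq> 0\<close>) on all of it; since every vector is a combination of \<open>S\<close> plus a vector orthogonal to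
  \<open>S\<close>, the complement lies in the radical of the form and is zero.
\<close>

lemma exists_orthogonal_spanning_set:
  fixes b :: "'b \<Rightarrow> 'b \<Rightarrow> 'a"
  assumes E: "finite E"
    and b_add: "\<And>x y z. b (x + y) z = b x z + b y z"
    and b_scale: "\<And>c x z. b (scale c x) z = c * b x z"
    and b_sym: "\<And>x y. b x y = b y x"
    and nondeg: "\<And>x. x \<in> span E \<Longrightarrow> (\<And>y. y \<in> span E \<Longrightarrow> b x y = 0) \<Longrightarrow> x = 0"
    and two: "(2 :: 'a) \<noteq> 0"
  shows "\<exists>S. finite S \<and> S \<subseteq> span E \<and> (\<forall>x \<in> S. \<forall>y \<in> S. x \<noteq> y \<longrightarrow> b x y = 0) \<and>
      (\<forall>x \<in> S. b x x \<noteq> 0) \<and> span E \<subseteq> span S"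
proof -
  let ?P = "\<lambda>S. finite S \<and> S \<subseteq> span E \<and> (\<forall>x \<in> S. \<forall>y \<in> S. x \<noteq> y \<longrightarrow> b x y = 0) \<and>
      (\<forall>x \<in> S. b x x \<noteq> 0)"
  have b_zero: "b 0 z = 0" for z using b_scale[of 0 0 z] by simp
  have b_sum: "b (\<Sum>x\<in>S. scale (f x) x) z = (\<Sum>x\<in>S. f x * b x z)" for S f z
    by (induction S rule: infinite_finite_induct) (simp_all add: b_zero b_add b_scale)
  have b_diff: "b (x - y) z = b x z - b y z" for x y z
    using b_add[of "x - y" y z] by simp
  have b_sum_orth: "b (\<Sum>x\<in>S. scale (f x) x) y = f y * b y y" if "?P S" "y \<in> S" for S f y
  proof -
    have "(\<Sum>x\<in>S. f x * b x y) = (\<Sum>x\<in>S. if x = y then f y * b y y else 0)"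
      by (rule sum.cong) (use that in auto)
    then show ?thesis using that by (simp add: b_sum)
  qed
  have bound: "card S \<le> card E" if S: "?P S" for S
  proof -
    have "independent S"
    proof (rule independent_if_scalars_zero)
      show "f y = 0" if "(\<Sum>x\<in>S. scale (f x) x) = 0" "y \<in> S" for f y
        using b_sum_orth[OF S that(2), of f] that S by (simp add: b_zero)
    qed (use S in simp)
    then show ?thesis using independent_span_bound[OF E] S by blast
  qed
  have "?P {}" by simp
  moreover have "\<forall>S. ?P S \<longrightarrow> card S < Suc (card E)" using bound by (simp add: less_Suc_eq_le)
  ultimately have "\<exists>S. ?P S \<and> (\<forall>T. ?P T \<longrightarrow> card T \<le> card S)"
    by (rule ex_has_greatest_nat[of ?P _ card])
  then obtain S where S: "?P S" and max: "\<And>T. ?P T \<Longrightarrow> card T \<le> card S"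
    by blast
  define orth where "orth w \<longleftrightarrow> w \<in> span E \<and> (\<forall>v \<in> S. b w v = 0)" for w
  have isotropic: "b w w = 0" if w: "orth w" for w
  proof (rule ccontr)
    assume nz: "b w w \<noteq> 0"
    then have "w \<notin> S" using w by (auto simp: orth_def)
    moreover have "b v w = 0" if "v \<in> S" for v using that w b_sym[of v w] by (simp add: orth_def)
    then have "?P (insert w S)" using S w nz by (auto simp: orth_def)
    ultimately show False using max[of "insert w S"] S by simp
  qed
  have orth_zero: "b w w' = 0" if w: "orth w" and w': "orth w'" for w w'
  proof -
    have "orth (w + w')" using w w' by (simp add: orth_def b_add span_add)
    then have "b (w + w') (w + w') = 0" by (rule isotropic)
    moreover have "b (w + w') (w + w') = b w w + 2 * b w w' + b w' w'"
      using b_sym[of w "w + w'"] b_sym[of w' "w + w'"] b_sym[of w' w] by (simp add: b_add)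
    ultimately show ?thesis using isotropic[OF w] isotropic[OF w'] two by simp
  qed
  define proj where "proj u = (\<Sum>v\<in>S. scale (b u v / b v v) v)" for u
  have proj_span: "proj u \<in> span S" for u
    unfolding proj_def by (intro span_sum span_scale span_base)
  have "span S \<subseteq> span E" by (rule span_minimal) (use S in simp_all)
  then have orth_proj: "orth (u - proj u)" if "u \<in> span E" for u
    using that proj_span[of u] S span_diff[of u E "proj u"]
    by (auto simp: orth_def b_diff proj_def b_sum_orth[OF S])
  have "u \<in> span S" if u: "u \<in> span E" for u
  proof -
    have "u - proj u = 0"
    proof (rule nondeg)
      show "u - proj u \<in> span E" using orth_proj[OF u] by (simp add: orth_def)
      show "b (u - proj u) y = 0" if y: "y \<in> span E" for y
      proof -
        have "b (proj y) (u - proj u) = (\<Sum>v\<in>S. (b y v / b v v) * b v (u - proj u))"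
          unfolding proj_def by (rule b_sum)
        also have "\<dots> = 0"
          using orth_proj[OF u] b_sym[of _ "u - proj u"] by (intro sum.neutral) (simp add: orth_def)
        finally have "b (proj y) (u - proj u) = 0" .
        moreover have "b (y - proj y) (u - proj u) = 0"
          by (rule orth_zero[OF orth_proj[OF y] orth_proj[OF u]])
        ultimately show ?thesis using b_sym[of "u - proj u" y] by (simp add: b_diff)
      qed
    qed
    then show ?thesis using proj_span[of u] by simp
  qed
  then show ?thesis using S by blast
qed

end

section \<open>The free algebra\<close>

lemma poly_mapping_sum_single:
  "p = (\<Sum>w \<in> Poly_Mapping.keys p. Poly_Mapping.single w (Poly_Mapping.lookup p w))"
proof (rule poly_mapping_eqI)
  fix v
  have "(\<Sum>w \<in> Poly_Mapping.keys p. (Poly_Mapping.lookup p w when w = v)) = Poly_Mapping.lookup p v"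
    by (cases "v \<in> Poly_Mapping.keys p")
      (auto simp: when_def in_keys_iff)
  then show "Poly_Mapping.lookup p v = Poly_Mapping.lookup
      (\<Sum>w \<in> Poly_Mapping.keys p. Poly_Mapping.single w (Poly_Mapping.lookup p w)) v"
    by (simp add: lookup_sum lookup_single)
qed

lemma const_central: "p * const c = const c * p"
proof -
  have "Poly_Mapping.single w d * const c = const c * Poly_Mapping.single w d"
    for w :: word and d :: 'a
    by (simp add: const_def mult_single mult.commute)
  then show ?thesis
    by (subst (1 2) poly_mapping_sum_single[of p]) (simp only: sum_distrib_left sum_distrib_right)
qed

text \<open>
  Scalar multiplication gets its own constant, so that a normal form can move all scalars to the
  front of a product.
\<close>

definition scl :: "'k::field \<Rightarrow> (word \<Rightarrow>\<^sub>0 'k) \<Rightarrow> word \<Rightarrow>\<^sub>0 'k" where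
  "scl c p = const c * p"

lemma lookup_scl: "Poly_Mapping.lookup (scl c p) w = c * Poly_Mapping.lookup p w"
proof -
  have "scl c p = Poly_Mapping.map ((*) c) p"
    by (simp add: scl_def const_def mult_map_scale_conv_mult)
  then show ?thesis by (simp add: Poly_Mapping.map.rep_eq when_def)
qed

global_interpretation VS: vector_space scl
  by standard (auto intro!: poly_mapping_eqI simp: lookup_scl lookup_add algebra_simps)

lemma mult_scl [simp]: "scl c p * q = scl c (p * q)" "p * scl c q = scl c (p * q)"
  using const_central[of p c] by (simp_all add: scl_def mult.assoc[symmetric])

lemma const_conv_scl: "const c = scl c 1"
  by (simp add: scl_def)

lemma mult_const [simp]: "const c * p = scl c p" "p * const c = scl c p"
  by (simp_all add: const_conv_scl)

lemma free_algebra_ops [simp]: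
  "x \<otimes>\<^bsub>free_algebra n\<^esub> y = x * y" "x \<oplus>\<^bsub>free_algebra n\<^esub> y = x + y"
  "\<one>\<^bsub>free_algebra n\<^esub> = 1" "\<zero>\<^bsub>free_algebra n\<^esub> = 0"
  by (simp_all add: free_algebra_def)

lemma free_algebra_closed [simp]:
  fixes p q :: "word \<Rightarrow>\<^sub>0 'k::field"
  shows "(0 :: word \<Rightarrow>\<^sub>0 'k) \<in> carrier (free_algebra n)"
    and "(1 :: word \<Rightarrow>\<^sub>0 'k) \<in> carrier (free_algebra n)"
    and "p \<in> carrier (free_algebra n) \<Longrightarrow> q \<in> carrier (free_algebra n) \<Longrightarrow>
      p + q \<in> carrier (free_algebra n)"
    and "p \<in> carrier (free_algebra n) \<Longrightarrow> q \<in> carrier (free_algebra n) \<Longrightarrow>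
      p * q \<in> carrier (free_algebra n)"
    and "(const c :: word \<Rightarrow>\<^sub>0 'k) \<in> carrier (free_algebra n)"
    and "i \<le> n \<Longrightarrow> (gen i :: word \<Rightarrow>\<^sub>0 'k) \<in> carrier (free_algebra n)"
    and "p \<in> carrier (free_algebra n) \<Longrightarrow> - p \<in> carrier (free_algebra n)"
    and "p \<in> carrier (free_algebra n) \<Longrightarrow> q \<in> carrier (free_algebra n) \<Longrightarrow>
      p - q \<in> carrier (free_algebra n)"
    and "p \<in> carrier (free_algebra n) \<Longrightarrow> scl c p \<in> carrier (free_algebra n)"
proof -
  let ?F = "free_algebra n :: (word \<Rightarrow>\<^sub>0 'k) ring"
  interpret ring ?F by (rule free_algebra_ring)
  show zero: "(0 :: word \<Rightarrow>\<^sub>0 'k) \<in> carrier ?F" and "(1 :: word \<Rightarrow>\<^sub>0 'k) \<in> carrier ?F"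
    using zero_closed one_closed by simp_all
  show add: "p + q \<in> carrier ?F" if "p \<in> carrier ?F" "q \<in> carrier ?F" for p q
    using a_closed[OF that] by simp
  show mult: "p * q \<in> carrier ?F" if "p \<in> carrier ?F" "q \<in> carrier ?F" for p q
    using m_closed[OF that] by simp
  show const: "const c \<in> carrier ?F" for c
    by (simp add: const_def free_algebra_def zero_word_def)
  show "(gen i :: word \<Rightarrow>\<^sub>0 'k) \<in> carrier ?F" if "i \<le> n" using that by (simp add: gen_def free_algebra_def)
  show uminus: "- p \<in> carrier ?F" if "p \<in> carrier ?F" for p
    using that by (simp add: free_algebra_def)
  show "p - q \<in> carrier ?F" if "p \<in> carrier ?F" "q \<in> carrier ?F" for p q
    using add[OF that(1) uminus[OF that(2)]] by simp
  show "scl c p \<in> carrier ?F" if "p \<in> carrier ?F"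
    using mult[OF const that] by simp
qed

lemma free_algebra_minus:
  fixes p q :: "word \<Rightarrow>\<^sub>0 'k::field"
  assumes "p \<in> carrier (free_algebra n)" "q \<in> carrier (free_algebra n)"
  shows "p \<ominus>\<^bsub>free_algebra n\<^esub> q = p - q"
proof -
  interpret ring "free_algebra n :: (word \<Rightarrow>\<^sub>0 'k) ring" by (rule free_algebra_ring)
  have "\<ominus>\<^bsub>free_algebra n\<^esub> q = - q"
    by (rule minus_equality) (use assms in simp_all)
  then show ?thesis by (simp add: a_minus_def)
qed

lemma free_algebra_induct [consumes 1, case_names const add gen_mult]:
  assumes p: "p \<in> carrier (free_algebra n)"
    and const: "\<And>c. P (const c)"
    and add: "\<And>p q. p \<in> carrier (free_algebra n) \<Longrightarrow> q \<in> carrier (free_algebra n) \<Longrightarrow>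
      P p \<Longrightarrow> P q \<Longrightarrow> P (p + q)"
    and gen_mult: "\<And>i p. i \<le> n \<Longrightarrow> p \<in> carrier (free_algebra n) \<Longrightarrow> P p \<Longrightarrow> P (gen i * p)"
  shows "P p"
proof -
  have single: "P (Poly_Mapping.single (Word l) c) \<and>
      Poly_Mapping.single (Word l) c \<in> carrier (free_algebra n)" if "set l \<subseteq> {0..n}" for l c
    using that
  proof (induction l)
    case Nil
    have "Poly_Mapping.single (Word []) c = Defs.const c" by (simp add: const_def zero_word_def)
    then show ?case using const by simp
  next
    case (Cons i l)
    have "Poly_Mapping.single (Word (i # l)) c = gen i * Poly_Mapping.single (Word l) c"
      by (simp add: gen_def mult_single plus_word_def)
    then show ?case using Cons gen_mult by simp
  qed
  have "P (\<Sum>w\<in>W. Poly_Mapping.single w (f w)) \<and>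
      (\<Sum>w\<in>W. Poly_Mapping.single w (f w)) \<in> carrier (free_algebra n)"
    if "finite W" "\<forall>w \<in> W. set (letters w) \<subseteq> {0..n}" for W and f :: "word \<Rightarrow> 'a"
    using that
  proof (induction W)
    case empty
    have "Defs.const (0 :: 'a) = 0" by (simp add: const_def)
    then show ?case using const[of 0] by simp
  next
    case (insert w W)
    then show ?case using add single[of "letters w" "f w"] by simp
  qed
  from this[of "Poly_Mapping.keys p" "Poly_Mapping.lookup p"] p
  show ?thesis using poly_mapping_sum_single[of p] by (simp add: free_algebra_def)
qed

fun subproducts :: "'a::monoid_mult list \<Rightarrow> 'a set" where
  "subproducts [] = {1}"
| "subproducts (x # xs) = subproducts xs \<union> (*) x ` subproducts xs"

lemma finite_subproducts: "finite (subproducts xs)"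
  by (induction xs) auto

lemma one_in_subproducts: "1 \<in> subproducts xs"
  by (induction xs) auto

lemma span_subproducts_Cons:
  "z \<in> VS.span (subproducts (x # xs)) \<longleftrightarrow>
    (\<exists>s \<in> VS.span (subproducts xs). \<exists>t \<in> VS.span (subproducts xs). z = s + x * t)"
proof -
  interpret mx: Vector_Spaces.linear scl scl "(*) x"
    by standard (simp_all add: algebra_simps)
  show ?thesis
    by (auto simp: VS.span_Un mx.span_image)
qed

section \<open>Calculations modulo an ideal of the free algebra\<close>

locale free_algebra_ideal =
  fixes n :: nat and K :: "(word \<Rightarrow>\<^sub>0 'k::field) set"
  assumes ideal: "ideal K (free_algebra n)"
begin

abbreviation F where "F \<equiv> carrier (free_algebra n) :: (word \<Rightarrow>\<^sub>0 'k) set"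

definition cong (infix "\<approx>" 50) where "x \<approx> y \<longleftrightarrow> x - y \<in> K"

lemma K_closed:
  shows K_subset: "K \<subseteq> F"
    and K_zero: "0 \<in> K"
    and K_add: "x \<in> K \<Longrightarrow> y \<in> K \<Longrightarrow> x + y \<in> K"
    and K_mult_left: "a \<in> F \<Longrightarrow> x \<in> K \<Longrightarrow> a * x \<in> K"
    and K_mult_right: "a \<in> F \<Longrightarrow> x \<in> K \<Longrightarrow> x * a \<in> K"
    and K_scl: "x \<in> K \<Longrightarrow> scl c x \<in> K"
    and K_uminus: "x \<in> K \<Longrightarrow> - x \<in> K"
proof -
  interpret ideal K "free_algebra n" by (rule ideal)
  note A = additive_subgroup_axioms
  show "K \<subseteq> F" by (rule additive_subgroup.a_subset[OF A])
  show "0 \<in> K" using additive_subgroup.zero_closed[OF A] by simp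
  show "x + y \<in> K" if "x \<in> K" "y \<in> K" using additive_subgroup.a_closed[OF A that] by simp
  show l: "a * x \<in> K" if "a \<in> F" "x \<in> K" for a x using I_l_closed[OF that(2,1)] by simp
  show "x * a \<in> K" if "a \<in> F" "x \<in> K" using I_r_closed[OF that(2,1)] by simp
  show scl: "scl c x \<in> K" if "x \<in> K" for c x
    using l[of "const c" x] that by simp
  show "- x \<in> K" if "x \<in> K" using scl[of x "-1"] that by simp
qed

lemma cong_refl [simp]: "x \<approx> x"
  by (simp add: cong_def K_zero)

lemma cong_sym: "x \<approx> y \<Longrightarrow> y \<approx> x"
  unfolding cong_def using K_uminus[of "x - y"] by simp

lemma cong_trans [trans]: "x \<approx> y \<Longrightarrow> y \<approx> z \<Longrightarrow> x \<approx> z"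
  unfolding cong_def using K_add[of "x - y" "y - z"] by simp

lemma cong_add: "x \<approx> y \<Longrightarrow> x' \<approx> y' \<Longrightarrow> x + x' \<approx> y + y'"
  unfolding cong_def using K_add[of "x - y" "x' - y'"] by (simp add: algebra_simps)

lemma cong_uminus: "x \<approx> y \<Longrightarrow> - x \<approx> - y"
  unfolding cong_def using K_uminus[of "x - y"] by simp

lemma cong_diff: "x \<approx> y \<Longrightarrow> x' \<approx> y' \<Longrightarrow> x - x' \<approx> y - y'"
  using cong_add[OF _ cong_uminus, of x y x' y'] by simp

lemma cong_mult_left: "a \<in> F \<Longrightarrow> x \<approx> y \<Longrightarrow> a * x \<approx> a * y"
  unfolding cong_def using K_mult_left[of a "x - y"] by (simp add: algebra_simps)

lemma cong_mult_right: "a \<in> F \<Longrightarrow> x \<approx> y \<Longrightarrow> x * a \<approx> y * a"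
  unfolding cong_def using K_mult_right[of a "x - y"] by (simp add: algebra_simps)

lemma cong_scl: "x \<approx> y \<Longrightarrow> scl c x \<approx> scl c y"
  unfolding cong_def using K_scl[of "x - y" c] by (simp add: VS.scale_right_diff_distrib)

lemma cong_zero_iff: "x \<approx> 0 \<longleftrightarrow> x \<in> K"
  by (simp add: cong_def)

text \<open>
  Elements whose squares and anticommutators are scalars can be sorted: multiplying an ordered
  product by one of the factors gives, up to scalars, ordered products again.
\<close>

lemma span_subproducts_closed:
  assumes "set xs \<subseteq> F"
    and "\<And>x. x \<in> set xs \<Longrightarrow> \<exists>c. x * x \<approx> const c"
    and "\<And>x y. x \<in> set xs \<Longrightarrow> y \<in> set xs \<Longrightarrow> \<exists>c. x * y + y * x \<approx> const c"
    and "y \<in> set xs" "s \<in> VS.span (subproducts xs)"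
  shows "\<exists>t \<in> VS.span (subproducts xs). y * s \<approx> t"
  using assms
proof (induction xs arbitrary: y s)
  case Nil
  then show ?case by simp
next
  case (Cons x xs)
  have sub: "VS.span (subproducts xs) \<subseteq> F"
  proof (rule VS.span_minimal)
    have "set xs \<subseteq> F" using Cons.prems by simp
    then show "subproducts xs \<subseteq> F" by (induction xs) auto
    show "VS.subspace F" by (auto intro!: VS.subspaceI)
  qed
  obtain s1 s2 where s: "s1 \<in> VS.span (subproducts xs)" "s2 \<in> VS.span (subproducts xs)"
      "s = s1 + x * s2"
    using Cons.prems(5) unfolding span_subproducts_Cons by blast
  have F: "s1 \<in> F" "s2 \<in> F" "x \<in> F" "y \<in> F" using s sub Cons.prems by auto
  show ?case
  proof (cases "y = x")
    case True
    obtain c where c: "x * x \<approx> const c" using Cons.prems(2)[of x] by auto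
    have "y * s = x * s1 + x * x * s2" unfolding s(3) True by (simp add: algebra_simps)
    also have "\<dots> \<approx> x * s1 + const c * s2" by (intro cong_add cong_mult_right c F cong_refl)
    finally have "y * s \<approx> scl c s2 + x * s1" by (simp add: add.commute)
    moreover have "scl c s2 + x * s1 \<in> VS.span (subproducts (x # xs))"
      unfolding span_subproducts_Cons using s VS.span_scale by blast
    ultimately show ?thesis by blast
  next
    case False
    then have y: "y \<in> set xs" using Cons.prems by simp
    have IH: "\<exists>t \<in> VS.span (subproducts xs). y * s \<approx> t" if "s \<in> VS.span (subproducts xs)" for s
      by (rule Cons.IH[OF _ _ _ y that]) (use Cons.prems in auto)
    obtain t1 t2 where t: "t1 \<in> VS.span (subproducts xs)" "t2 \<in> VS.span (subproducts xs)"
        "y * s1 \<approx> t1" "y * s2 \<approx> t2"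
      using IH[OF s(1)] IH[OF s(2)] by blast
    obtain c where c: "x * y + y * x \<approx> const c" using Cons.prems(3)[of x y] Cons.prems(4) by auto
    have "y * s = y * s1 + ((x * y + y * x) * s2 - x * (y * s2))"
      unfolding s(3) by (simp add: algebra_simps)
    also have "\<dots> \<approx> t1 + (const c * s2 - x * t2)"
      by (intro cong_add cong_diff cong_mult_right cong_mult_left c t F)
    finally have "y * s \<approx> (t1 + scl c s2) + x * (- t2)" by (simp add: algebra_simps)
    moreover have "(t1 + scl c s2) + x * (- t2) \<in> VS.span (subproducts (x # xs))"
      unfolding span_subproducts_Cons
      by (rule bexI[of _ "t1 + scl c s2"], rule bexI[of _ "- t2"])
        (use s t in \<open>auto intro: VS.span_add VS.span_scale VS.span_neg\<close>)
    ultimately show ?thesis by blast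
  qed
qed

text \<open>
  Maschke's averaging, one generator at a time. If \<open>P\<close> projects onto \<open>L\<close> and \<open>e\<^sup>2 = q \<noteq> 0\<close>, then
  \<open>y \<mapsto> (P y + e\<^sup>-\<^sup>1 P (e y)) / 2\<close> still projects onto \<open>L\<close> and commutes with \<open>e\<close>; it commutes with
  every element that anticommutes with \<open>e\<close> and with which \<open>P\<close> commutes, because the two signs cancel.
\<close>

lemma equivariant_projection:
  assumes two: "(2 :: 'k) \<noteq> 0"
    and L: "left_ideal (free_algebra n) L" "K \<subseteq> L"
    and S: "finite S" "S \<subseteq> F"
    and square: "\<And>x. x \<in> S \<Longrightarrow> \<exists>q. q \<noteq> 0 \<and> x * x \<approx> const q"
    and anti: "\<And>x y. x \<in> S \<Longrightarrow> y \<in> S \<Longrightarrow> x \<noteq> y \<Longrightarrow> x * y + y * x \<approx> 0"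
  shows "\<exists>P. Vector_Spaces.linear scl scl P \<and> range P \<subseteq> L \<and> (\<forall>y \<in> L. P y \<approx> y) \<and>
      (\<forall>x \<in> S. \<forall>y \<in> F. P (x * y) \<approx> x * P y)"
  using S square anti
proof (induction S)
  interpret ring "free_algebra n :: (word \<Rightarrow>\<^sub>0 'k) ring" by (rule free_algebra_ring)
  note L_closed = left_ideal_facts[OF L(1), simplified]
  have L_scl: "scl c x \<in> L" if "x \<in> L" for c x
    using L_closed(4)[of "const c" x] that by simp
  {
    case empty
    interpret vector_space_pair scl scl by standard
    have "VS.subspace L" by (rule VS.subspaceI) (use L_closed L_scl in auto)
    then have "\<exists>P. range P \<subseteq> L \<and> Vector_Spaces.linear scl scl P \<and> (\<forall>y \<in> L. P (id y) = y)"
      by (intro linear_exists_left_inverse_on VS.linear_id) auto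
    then show ?case by auto
  next
    case (insert e S)
    obtain P where P: "Vector_Spaces.linear scl scl P" "range P \<subseteq> L" "\<And>y. y \<in> L \<Longrightarrow> P y \<approx> y"
        "\<And>x y. x \<in> S \<Longrightarrow> y \<in> F \<Longrightarrow> P (x * y) \<approx> x * P y"
      using insert.IH insert.prems by auto
    interpret P: Vector_Spaces.linear scl scl P by (rule P(1))
    obtain q where q: "q \<noteq> 0" "e * e \<approx> const q" using insert.prems(2)[of e] by auto
    have e: "e \<in> F" using insert.prems by simp
    have PL: "P y \<in> L" for y using P(2) by blast
    have PF: "P y \<in> F" for y using PL L_closed(1) by blast
    have P_cong: "P x \<approx> P y" if "x \<approx> y" for x y
    proof -
      have "x - y \<in> K" using that by (simp add: cong_def)
      then have "P (x - y) \<approx> 0"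
        using P(3)[of "x - y"] L(2) cong_trans[of "P (x - y)" "x - y" 0] by (auto simp: cong_zero_iff)
      then show ?thesis by (simp add: P.diff cong_zero_iff cong_def)
    qed
    define P' where "P' y = scl (1/2) (P y + scl (1/q) (e * P (e * y)))" for y
    have ee: "e * (e * y) \<approx> scl q y" if "y \<in> F" for y
      using cong_mult_right[OF that q(2)] by (simp add: mult.assoc)
    have "Vector_Spaces.linear scl scl P'"
      by standard (simp_all add: P'_def P.add P.scale algebra_simps VS.scale_right_distrib)
    moreover have "range P' \<subseteq> L"
      unfolding P'_def using L_closed PL L_scl e by auto
    moreover have "P' y \<approx> y" if y: "y \<in> L" for y
    proof -
      have yF: "y \<in> F" using y L_closed(1) by blast
      have "e * P (e * y) \<approx> e * (e * y)"
        by (rule cong_mult_left[OF e P(3)]) (use L_closed e y in auto)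
      also have "\<dots> \<approx> scl q y" by (rule ee[OF yF])
      finally have "P' y \<approx> scl (1/2) (y + scl (1/q) (scl q y))"
        unfolding P'_def by (intro cong_scl cong_add P(3) y)
      also have "scl (1/2) (y + scl (1/q) (scl q y)) = scl (1/2) (scl 2 y)"
        using q(1) VS.scale_left_distrib[of 1 1 y] by simp
      also have "\<dots> = y" using two by simp
      finally show ?thesis .
    qed
    moreover have "P' (x * y) \<approx> x * P' y" if x: "x \<in> insert e S" and y: "y \<in> F" for x y
    proof (cases "x = e")
      case True
      have "P (e * (e * y)) \<approx> scl q (P y)"
        using P_cong[OF ee[OF y]] by (simp add: P.scale)
      then have "P' (e * y) \<approx> scl (1/2) (P (e * y) + scl (1/q) (e * scl q (P y)))"
        unfolding P'_def by (intro cong_scl cong_add cong_mult_left e) auto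
      also have "\<dots> = scl (1/2) (e * P y + scl (1/q) (scl q (P (e * y))))"
        using q(1) by (simp add: add.commute)
      also have "\<dots> \<approx> scl (1/2) (e * P y + scl (1/q) (e * (e * P (e * y))))"
        by (intro cong_scl cong_add cong_refl cong_sym[OF ee] PF)
      also have "\<dots> = e * P' y" by (simp add: P'_def algebra_simps)
      finally show ?thesis using True by simp
    next
      case False
      then have xS: "x \<in> S" and xF: "x \<in> F" using x insert.prems by auto
      have anti: "e * (x * z) \<approx> - (x * (e * z))" if "z \<in> F" for z
      proof -
        have "(e * x + x * e) * z \<approx> 0 * z"
          using insert.prems(3)[of e x] xS False by (intro cong_mult_right that) auto
        then have "(e * x + x * e) * z - x * (e * z) \<approx> 0 * z - x * (e * z)"
          by (rule cong_diff) simp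
        then show ?thesis by (simp add: algebra_simps)
      qed
      have "P (e * (x * y)) \<approx> - P (x * (e * y))"
        using P_cong[OF anti[OF y]] by (simp add: P.neg)
      also have "\<dots> \<approx> - (x * P (e * y))"
        by (intro cong_uminus P(4) xS) (use e y in simp)
      finally have "e * P (e * (x * y)) \<approx> e * - (x * P (e * y))" by (rule cong_mult_left[OF e])
      also have "\<dots> = - (e * (x * P (e * y)))" by simp
      also have "\<dots> \<approx> - (- (x * (e * P (e * y))))" by (intro cong_uminus anti PF)
      finally have "P' (x * y) \<approx> scl (1/2) (x * P y + scl (1/q) (x * (e * P (e * y))))"
        unfolding P'_def by (intro cong_scl cong_add P(4) xS y) simp
      also have "\<dots> = x * P' y" by (simp add: P'_def algebra_simps)
      finally show ?thesis .
    qed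
    ultimately show ?case by blast
  }
qed

end

section \<open>Operators on Fock space\<close>

text \<open>
  The function \<open>f\<close> on sets of indices stands for the element of the exterior algebra whose coefficient
  at the product of the \<open>e\<^sub>j\<close>, \<open>j \<in> S\<close>, in increasing order is \<open>f S\<close>. Then \<open>create i\<close> is left
  multiplication by \<open>e\<^sub>i\<close>, \<open>annihilate i\<close> is contraction with the \<open>i\<close>-th coordinate, and the sign
  comes from moving \<open>e\<^sub>i\<close> past the factors with smaller index.
\<close>

definition fock_sign :: "nat \<Rightarrow> nat set \<Rightarrow> 'k::field" where
  "fock_sign i S = (- 1) ^ card {j \<in> S. j < i}"

definition create :: "nat \<Rightarrow> (nat set \<Rightarrow> 'k) \<Rightarrow> nat set \<Rightarrow> 'k::field" where
  "create i f S = (if i \<in> S then fock_sign i S * f (S - {i}) else 0)"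

definition annihilate :: "nat \<Rightarrow> (nat set \<Rightarrow> 'k) \<Rightarrow> nat set \<Rightarrow> 'k::field" where
  "annihilate i f S = (if i \<in> S then 0 else fock_sign i S * f (insert i S))"

lemma fock_sign_square: "fock_sign i S * fock_sign i S = (1 :: 'k::field)"
  by (simp add: fock_sign_def power_mult_distrib[symmetric])

lemma fock_sign_square': "fock_sign i S * (fock_sign i S * c) = (c :: 'k::field)"
  by (simp add: mult.assoc[symmetric] fock_sign_square)

lemma fock_sign_insert:
  assumes "j \<notin> S"
  shows "fock_sign i (insert j S) = (if j < i then - fock_sign i S else (fock_sign i S :: 'k::field))"
proof (cases "j < i")
  case True
  then have "{l \<in> insert j S. l < i} = insert j {l \<in> S. l < i}" by auto
  then show ?thesis using True assms by (simp add: fock_sign_def)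
next
  case False
  then have "{l \<in> insert j S. l < i} = {l \<in> S. l < i}" by auto
  then show ?thesis using False by (simp add: fock_sign_def)
qed

lemma fock_sign_remove:
  assumes "j \<in> S"
  shows "fock_sign i (S - {j}) = (if j < i then - fock_sign i S else (fock_sign i S :: 'k::field))"
  using fock_sign_insert[of j "S - {j}" i, where ?'k = 'k] insert_Diff[OF assms]
  by (auto split: if_splits)

lemma create_anticommute:
  "create i (create j f) S + create j (create i f) S = (0 :: 'k::field)"
proof (cases "i = j")
  case False
  have "S - {i} - {j} = S - {j} - {i}" by blast
  with False show ?thesis
    by (cases i j rule: linorder_cases) (simp_all add: create_def fock_sign_remove)
qed (simp add: create_def)

lemma annihilate_anticommute:
  "annihilate i (annihilate j f) S + annihilate j (annihilate i f) S = (0 :: 'k::field)"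
proof (cases "i = j")
  case False
  then show ?thesis
    by (cases i j rule: linorder_cases)
      (simp_all add: annihilate_def fock_sign_insert insert_commute[of i j])
qed (simp add: annihilate_def)

lemma create_annihilate_anticommute:
  "create i (annihilate j f) S + annihilate j (create i f) S = (if i = j then f S else (0 :: 'k::field))"
proof (cases "i = j")
  case True
  show ?thesis
    unfolding True
    by (auto simp: annihilate_def create_def fock_sign_insert fock_sign_remove fock_sign_square'
        insert_absorb)
next
  case False
  then have "insert j S - {i} = insert j (S - {i})" by auto
  then show ?thesis using False
    by (cases i j rule: linorder_cases)
      (simp_all add: annihilate_def create_def fock_sign_insert fock_sign_remove)
qed

text \<open>
  The algebra defined by \<open>e\<^sub>i e\<^sub>j + e\<^sub>j e\<^sub>i = Q\<^sub>i\<^sub>j + Q\<^sub>j\<^sub>i\<close> acts on the exterior algebra, here the functions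
  on sets of indices, through ``multiply by \<open>e\<^sub>i\<close> plus contract with \<open>Q\<^sub>i\<close>''.
\<close>

definition fock :: "nat \<Rightarrow> (nat \<Rightarrow> nat \<Rightarrow> 'k) \<Rightarrow> nat \<Rightarrow> (nat set \<Rightarrow> 'k) \<Rightarrow> nat set \<Rightarrow> 'k::field" where
  "fock n Q i f S = create i f S + (\<Sum>l\<le>n. Q i l * annihilate l f S)"

lemma fock_anticommute:
  assumes "i \<le> n" "j \<le> n"
  shows "fock n Q i (fock n Q j f) S + fock n Q j (fock n Q i f) S = (Q i j + Q j i) * f S"
proof -
  have create_fock: "create i (fock n Q j f) S =
      create i (create j f) S + (\<Sum>l\<le>n. Q j l * create i (annihilate l f) S)" for i j
    by (simp add: create_def fock_def algebra_simps sum_distrib_left)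
  have annihilate_fock: "annihilate m (fock n Q j f) S =
      annihilate m (create j f) S + (\<Sum>l\<le>n. Q j l * annihilate m (annihilate l f) S)" for m j
    by (simp add: annihilate_def fock_def algebra_simps sum_distrib_left)
  have expand: "fock n Q i (fock n Q j f) S = create i (create j f) S
      + (\<Sum>l\<le>n. Q j l * create i (annihilate l f) S)
      + (\<Sum>l\<le>n. Q i l * annihilate l (create j f) S)
      + (\<Sum>l\<le>n. \<Sum>m\<le>n. Q i l * Q j m * annihilate l (annihilate m f) S)" for i j
    unfolding fock_def[of n Q i] create_fock annihilate_fock
    by (simp add: algebra_simps sum.distrib sum_distrib_left)
  have double: "(\<Sum>l\<le>n. \<Sum>m\<le>n. Q i l * Q j m * annihilate l (annihilate m f) S)
      + (\<Sum>l\<le>n. \<Sum>m\<le>n. Q j l * Q i m * annihilate l (annihilate m f) S) = 0" (is "?A + ?B = 0")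
  proof -
    have "?B = (\<Sum>l\<le>n. \<Sum>m\<le>n. Q j m * Q i l * annihilate m (annihilate l f) S)"
      by (rule sum.swap)
    then have "?A + ?B = (\<Sum>l\<le>n. \<Sum>m\<le>n. Q i l * Q j m *
        (annihilate l (annihilate m f) S + annihilate m (annihilate l f) S))"
      by (simp add: sum.distrib[symmetric] algebra_simps)
    then show ?thesis by (simp add: annihilate_anticommute)
  qed
  have single: "(\<Sum>l\<le>n. Q j l * create i (annihilate l f) S)
      + (\<Sum>l\<le>n. Q j l * annihilate l (create i f) S) = Q j i * f S" if "i \<le> n" for i j
  proof -
    have "(\<Sum>l\<le>n. Q j l * create i (annihilate l f) S)
        + (\<Sum>l\<le>n. Q j l * annihilate l (create i f) S)
        = (\<Sum>l\<le>n. Q j l * (create i (annihilate l f) S + annihilate l (create i f) S))"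
      by (simp add: sum.distrib distrib_left)
    also have "\<dots> = (\<Sum>l\<le>n. if i = l then Q j l * f S else 0)"
      by (rule sum.cong) (auto simp: create_annihilate_anticommute)
    also have "\<dots> = Q j i * f S" using that by simp
    finally show ?thesis .
  qed
  have "fock n Q i (fock n Q j f) S + fock n Q j (fock n Q i f) S = Q j i * f S + Q i j * f S"
    using create_anticommute[of i j f S] double single[OF assms(1), of j] single[OF assms(2), of i]
    unfolding expand by (simp add: algebra_simps)
  then show ?thesis by (simp add: algebra_simps)
qed

lemma fock_sum:
  "fock n Q i (\<lambda>S. \<Sum>w\<in>W. c w * h w S) S = (\<Sum>w\<in>W. c w * fock n Q i (h w) S)"
proof -
  have "(\<Sum>l\<le>n. Q i l * annihilate l (\<lambda>S. \<Sum>w\<in>W. c w * h w S) S) =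
      (\<Sum>w\<in>W. \<Sum>l\<le>n. Q i l * (c w * annihilate l (h w) S))"
    by (subst sum.swap) (auto intro!: sum.cong simp: annihilate_def sum_distrib_left algebra_simps)
  then show ?thesis
    by (simp add: fock_def create_def sum_distrib_left sum.distrib[symmetric] algebra_simps)
qed

section \<open>The Fock representation and linear independence of the generators\<close>

definition rep :: "nat \<Rightarrow> (nat \<Rightarrow> nat \<Rightarrow> 'k) \<Rightarrow> (word \<Rightarrow>\<^sub>0 'k::field) \<Rightarrow> (nat set \<Rightarrow> 'k) \<Rightarrow> nat set \<Rightarrow> 'k"
where
  "rep n Q p f S = (\<Sum>w \<in> Poly_Mapping.keys p.
      Poly_Mapping.lookup p w * foldr (fock n Q) (letters w) f S)"

lemma rep_superset:
  assumes "finite W" "Poly_Mapping.keys p \<subseteq> W"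
  shows "rep n Q p f S = (\<Sum>w\<in>W. Poly_Mapping.lookup p w * foldr (fock n Q) (letters w) f S)"
  unfolding rep_def by (rule sum.mono_neutral_left) (use assms in \<open>auto simp: in_keys_iff\<close>)

lemma rep_add: "rep n Q (p + q) f S = rep n Q p f S + rep n Q q f S"
proof -
  let ?W = "Poly_Mapping.keys p \<union> Poly_Mapping.keys q"
  have W: "finite ?W" by simp
  show ?thesis
    using rep_superset[OF W Poly_Mapping.keys_add] rep_superset[OF W Un_upper1]
      rep_superset[OF W Un_upper2]
    by (simp add: lookup_add distrib_right sum.distrib)
qed

lemma rep_scl: "rep n Q (scl c p) f S = c * rep n Q p f S"
proof -
  have "Poly_Mapping.keys (scl c p) \<subseteq> Poly_Mapping.keys p"
    by (auto simp: in_keys_iff lookup_scl)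
  from rep_superset[OF finite_keys this] show ?thesis
    by (simp add: rep_def lookup_scl sum_distrib_left mult.assoc)
qed

lemma rep_sum: "rep n Q (\<Sum>x\<in>A. g x) f S = (\<Sum>x\<in>A. rep n Q (g x) f S)"
proof -
  have "rep n Q 0 f S = 0" by (simp add: rep_def)
  then show ?thesis by (induction A rule: infinite_finite_induct) (simp_all add: rep_add)
qed

lemma rep_single: "rep n Q (Poly_Mapping.single w c) f S = c * foldr (fock n Q) (letters w) f S"
  by (cases "c = 0") (simp_all add: rep_def lookup_single)

lemma rep_one: "rep n Q 1 f = f"
proof -
  have "letters 0 = []" by (simp add: zero_word_def)
  then show ?thesis using rep_single[of n Q 0 1 f] by (auto simp: fun_eq_iff)
qed

lemma rep_gen_mult: "rep n Q (gen i * p) f = fock n Q i (rep n Q p f)"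
proof
  fix S
  have "gen i * p = (\<Sum>w \<in> Poly_Mapping.keys p.
      Poly_Mapping.single (Word (i # letters w)) (Poly_Mapping.lookup p w))"
    by (subst poly_mapping_sum_single[of p])
      (simp add: gen_def sum_distrib_left mult_single plus_word_def)
  then have "rep n Q (gen i * p) f S = (\<Sum>w \<in> Poly_Mapping.keys p.
      Poly_Mapping.lookup p w * fock n Q i (foldr (fock n Q) (letters w) f) S)"
    by (simp add: rep_sum rep_single)
  also have "\<dots> = fock n Q i (rep n Q p f) S"
    by (simp add: fock_sum[symmetric] rep_def[abs_def])
  finally show "rep n Q (gen i * p) f S = fock n Q i (rep n Q p f) S" .
qed

lemma rep_mult:
  assumes "p \<in> carrier (free_algebra n)"
  shows "rep n Q (p * q) f = rep n Q p (rep n Q q f)"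
  using assms
proof (induction p rule: free_algebra_induct)
  case (const c)
  show ?case by (rule ext) (simp add: rep_scl const_conv_scl rep_one)
next
  case (add p p')
  then show ?case by (intro ext) (simp add: distrib_right rep_add)
next
  case (gen_mult i p)
  then show ?case by (simp add: mult.assoc rep_gen_mult)
qed

text \<open>
  The kernel of the representation contains the Clifford relations and hence the ideal that they
  generate; so whatever acts nontrivially is nonzero in the Clifford algebra.
\<close>

definition rep_kernel :: "nat \<Rightarrow> (nat \<Rightarrow> nat \<Rightarrow> 'k) \<Rightarrow> (word \<Rightarrow>\<^sub>0 'k::field) set" where
  "rep_kernel n Q = {p \<in> carrier (free_algebra n). \<forall>f S. rep n Q p f S = 0}"

lemma rep_kernel_ideal: "ideal (rep_kernel n Q) (free_algebra n)"
proof -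
  interpret ring "free_algebra n :: (word \<Rightarrow>\<^sub>0 'a) ring" by (rule free_algebra_ring)
  have "rep n Q 0 f = (\<lambda>S. 0)" for f by (rule ext) (simp add: rep_def)
  then have rep_0: "rep n Q a (\<lambda>S. 0) S = 0" if "a \<in> carrier (free_algebra n)" for a S
    using rep_mult[OF that, of Q 0] by simp
  have "left_ideal (free_algebra n) (rep_kernel n Q)"
  proof (rule left_idealI)
    show "a \<otimes>\<^bsub>free_algebra n\<^esub> p \<in> rep_kernel n Q"
      if "a \<in> carrier (free_algebra n)" "p \<in> rep_kernel n Q" for a p
    proof -
      have "rep n Q p f = (\<lambda>S. 0)" for f using that(2) by (auto simp: rep_kernel_def)
      then show ?thesis using that by (simp add: rep_kernel_def rep_mult rep_0)
    qed
  qed (auto simp: rep_kernel_def rep_add rep_def[of n Q 0])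
  then have "additive_subgroup (rep_kernel n Q) (free_algebra n)" by (simp add: left_ideal_def)
  then show ?thesis
    by (intro idealI free_algebra_ring additive_subgroup.a_subgroup)
      (use \<open>left_ideal (free_algebra n) (rep_kernel n Q)\<close> in
        \<open>auto simp: left_ideal_def rep_kernel_def rep_mult\<close>)
qed

lemma gen_anticommutator_in_rep_kernel:
  assumes "i \<le> n" "j \<le> n"
  shows "gen i * gen j + gen j * gen i - const (Q i j + Q j i) \<in> rep_kernel n Q"
proof -
  have "rep n Q (gen i) f = fock n Q i f" for i f
    using rep_gen_mult[of n Q i 1 f] by (simp add: rep_one)
  then have "rep n Q (gen i * gen j + gen j * gen i + scl (- (Q i j + Q j i)) 1) f S = 0" for f S
    using fock_anticommute[OF assms, of Q f S]
    by (simp only: rep_add rep_gen_mult rep_scl rep_one) (simp add: algebra_simps)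
  moreover have "gen i * gen j + gen j * gen i - const (Q i j + Q j i) =
      gen i * gen j + gen j * gen i + scl (- (Q i j + Q j i)) 1"
    by (simp only: const_conv_scl VS.scale_minus_left diff_conv_add_uminus)
  ultimately have "rep n Q (gen i * gen j + gen j * gen i - const (Q i j + Q j i)) f S = 0" for f S
    by (simp only:)
  then show ?thesis
    unfolding rep_kernel_def using assms by (intro CollectI conjI allI free_algebra_closed)
qed

text \<open>Applied to the vacuum, the indicator of the empty set, \<open>e\<^sub>i\<close> gives the indicator of \<open>{i}\<close>.\<close>

lemma independent_gens_mod_rep_kernel:
  assumes "(\<Sum>j\<le>n. scl (v j) (gen j)) \<in> rep_kernel n Q" "i \<le> n"
  shows "v i = 0"
proof -
  define vac :: "nat set \<Rightarrow> 'a" where "vac S = (if S = {} then 1 else 0)" for S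
  have "{l \<in> {i}. l < i} = {}" by auto
  then have "fock_sign i {i} = (1 :: 'a)"
    unfolding fock_sign_def by (simp only: card.empty power_0)
  then have "create j vac {i} = (if j = i then 1 else 0)" for j
    by (simp add: create_def vac_def)
  moreover have "annihilate l vac {i} = 0" for l by (simp add: annihilate_def vac_def)
  ultimately have vac: "fock n Q j vac {i} = (if j = i then 1 else 0)" for j
    by (simp add: fock_def)
  have "rep n Q (gen j) f = fock n Q j f" for j f
    using rep_gen_mult[of n Q j 1 f] by (simp add: rep_one)
  then have "rep n Q (\<Sum>j\<le>n. scl (v j) (gen j)) vac {i} = (\<Sum>j\<le>n. v j * (if j = i then 1 else 0))"
    by (simp add: rep_sum rep_scl vac)
  also have "\<dots> = (\<Sum>j\<le>n. if j = i then v j else 0)" by (rule sum.cong) auto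
  also have "\<dots> = v i" using assms(2) by simp
  finally show ?thesis using assms(1) by (simp add: rep_kernel_def)
qed


section \<open>Quotients of the free algebra by Clifford relations\<close>

lemma (in free_algebra_ideal) square_cong_const_iff:
  assumes two: "(2 :: 'k) \<noteq> 0"
  shows "x * x \<approx> const c \<longleftrightarrow> x * x + x * x \<approx> const (2 * c)"
proof -
  have double: "x * x + x * x = scl 2 (x * x)" using VS.scale_left_distrib[of 1 1 "x * x"] by simp
  show ?thesis
  proof
    assume "x * x \<approx> const c"
    then have "scl 2 (x * x) \<approx> scl 2 (const c)" by (rule cong_scl)
    then show "x * x + x * x \<approx> const (2 * c)" unfolding double by (simp add: const_conv_scl)
  next
    assume "x * x + x * x \<approx> const (2 * c)"
    then have "scl (1/2) (scl 2 (x * x)) \<approx> scl (1/2) (const (2 * c))"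
      unfolding double by (rule cong_scl)
    then show "x * x \<approx> const c" using two by (simp add: const_conv_scl)
  qed
qed

locale clifford_ideal = free_algebra_ideal n K
  for n :: nat and K :: "(word \<Rightarrow>\<^sub>0 'k::field) set" +
  fixes Q :: "nat \<Rightarrow> nat \<Rightarrow> 'k"
  assumes two: "(2 :: 'k) \<noteq> 0"
    and Q_sym: "Q i j = Q j i"
    and gen_anticommute: "i \<le> n \<Longrightarrow> j \<le> n \<Longrightarrow> gen i * gen j + gen j * gen i \<approx> const (2 * Q i j)"
begin

lemma square_of_anticommutator:
  "x * x + x * x \<approx> const (2 * c) \<Longrightarrow> x * x \<approx> const c"
  using square_cong_const_iff[OF two] by blast

text \<open>
  The form reads off the coefficients of one-letter words, which makes it bilinear on the whole free
  algebra and not just on the span of the generators.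
\<close>

definition form :: "(word \<Rightarrow>\<^sub>0 'k) \<Rightarrow> (word \<Rightarrow>\<^sub>0 'k) \<Rightarrow> 'k" where
  "form x y = (\<Sum>i\<le>n. \<Sum>j\<le>n.
      Poly_Mapping.lookup x (Word [i]) * Q i j * Poly_Mapping.lookup y (Word [j]))"

lemma form_add: "form (x + y) z = form x z + form y z"
  by (simp add: form_def lookup_add algebra_simps sum.distrib)

lemma form_scl: "form (scl c x) z = c * form x z"
  by (simp add: form_def lookup_scl algebra_simps sum_distrib_left)

lemma form_sym: "form x y = form y x"
  unfolding form_def by (subst sum.swap) (simp add: Q_sym mult_ac)

lemma lookup_gen: "Poly_Mapping.lookup (gen i) (Word [j]) = (if i = j then 1 else 0)"
  by (simp add: gen_def lookup_single)

lemma form_gen_right: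
  assumes "j \<le> n"
  shows "form x (gen j) = (\<Sum>i\<le>n. Q j i * Poly_Mapping.lookup x (Word [i]))"
proof -
  have "(\<Sum>l\<le>n. Poly_Mapping.lookup x (Word [i]) * Q i l * Poly_Mapping.lookup (gen j) (Word [l]))
      = (\<Sum>l\<le>n. if j = l then Q j i * Poly_Mapping.lookup x (Word [i]) else 0)" for i
    by (rule sum.cong) (auto simp: lookup_gen Q_sym)
  then show ?thesis using assms by (simp add: form_def)
qed

abbreviation V where "V \<equiv> VS.span (gen ` {..n})"

lemma anticommutator_form:
  assumes "x \<in> V" "y \<in> V"
  shows "x * y + y * x \<approx> const (2 * form x y)"
proof -
  have subspace: "VS.subspace {x. x * y + y * x \<approx> const (2 * form x y)}" for y
  proof (rule VS.subspaceI)
    have "form 0 y = 0" using form_scl[of 0 0 y] by simp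
    then show "0 \<in> {x. x * y + y * x \<approx> const (2 * form x y)}" by (simp add: const_conv_scl)
    show "x + z \<in> {x. x * y + y * x \<approx> const (2 * form x y)}"
      if "x \<in> {x. x * y + y * x \<approx> const (2 * form x y)}"
        "z \<in> {x. x * y + y * x \<approx> const (2 * form x y)}" for x z
    proof -
      have "(x * y + y * x) + (z * y + y * z) \<approx> const (2 * form x y) + const (2 * form z y)"
        by (rule cong_add) (use that in auto)
      then show ?thesis
        by (simp add: algebra_simps form_add const_conv_scl VS.scale_left_distrib)
    qed
    show "scl c x \<in> {x. x * y + y * x \<approx> const (2 * form x y)}"
      if "x \<in> {x. x * y + y * x \<approx> const (2 * form x y)}" for c x
    proof -
      have "scl c (x * y + y * x) \<approx> scl c (const (2 * form x y))"
        by (rule cong_scl) (use that in auto)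
      then show ?thesis
        by (simp add: form_scl const_conv_scl VS.scale_right_distrib algebra_simps)
    qed
  qed
  have gen_gen: "gen i * gen j + gen j * gen i \<approx> const (2 * form (gen i) (gen j))"
    if "i \<le> n" "j \<le> n" for i j
  proof -
    have "(\<Sum>l\<le>n. Q j l * Poly_Mapping.lookup (gen i) (Word [l])) = (\<Sum>l\<le>n. if i = l then Q j l else 0)"
      by (rule sum.cong) (auto simp: lookup_gen)
    then have "form (gen i) (gen j) = Q i j"
      using that by (simp add: form_gen_right Q_sym)
    then show ?thesis using gen_anticommute[OF that] by simp
  qed
  have gen_right: "x * gen j + gen j * x \<approx> const (2 * form x (gen j))" if "j \<le> n" for j
    using VS.span_induct[OF assms(1) subspace[of "gen j"]] gen_gen that by fastforce
  have "y * x + x * y \<approx> const (2 * form y x)"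
    using VS.span_induct[OF assms(2) subspace[of x]] gen_right
    by (fastforce simp: add.commute form_sym)
  then show ?thesis by (simp add: add.commute form_sym)
qed

lemma V_subset: "V \<subseteq> F"
  by (rule VS.span_minimal) (auto intro!: VS.subspaceI)

lemma V_lookup_zero:
  assumes "x \<in> V" "\<And>i. i \<le> n \<Longrightarrow> Poly_Mapping.lookup x (Word [i]) = 0"
  shows "x = 0"
proof (rule poly_mapping_eqI)
  fix w
  show "Poly_Mapping.lookup x w = Poly_Mapping.lookup 0 w"
  proof (cases "w \<in> (\<lambda>i. Word [i]) ` {..n}")
    case False
    have "VS.subspace {x. Poly_Mapping.lookup x w = 0}"
      by (rule VS.subspaceI) (auto simp: lookup_add lookup_scl)
    moreover have "gen ` {..n} \<subseteq> {x. Poly_Mapping.lookup x w = 0}"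
      using False by (auto simp: gen_def lookup_single when_def)
    ultimately have "V \<subseteq> {x. Poly_Mapping.lookup x w = 0}" by (rule VS.span_minimal[rotated])
    then show ?thesis using assms(1) by auto
  qed (use assms(2) in auto)
qed

lemma finite_dimensional_mod_K:
  "\<exists>B. finite B \<and> B \<subseteq> F \<and> (\<forall>p \<in> F. \<exists>s \<in> VS.span B. p \<approx> s)"
proof -
  let ?xs = "map gen [0..<Suc n] :: (word \<Rightarrow>\<^sub>0 'k) list"
  let ?B = "subproducts ?xs"
  have set_xs: "set ?xs = gen ` {..n}"
    by (simp only: set_map set_upt atLeast0LessThan lessThan_Suc_atMost)
  then have xs: "set ?xs \<subseteq> F" by auto
  have "subproducts ys \<subseteq> F" if "set ys \<subseteq> F" for ys :: "(word \<Rightarrow>\<^sub>0 'k) list"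
    using that by (induction ys) auto
  then have B: "?B \<subseteq> F" using xs by blast
  have "\<exists>s \<in> VS.span ?B. p \<approx> s" if "p \<in> F" for p
    using that
  proof (induction p rule: free_algebra_induct)
    case (const c)
    have "scl c 1 \<in> VS.span ?B" by (intro VS.span_scale VS.span_base one_in_subproducts)
    then show ?case by (metis const_conv_scl cong_refl)
  next
    case (add p q)
    then show ?case by (meson cong_add VS.span_add)
  next
    case (gen_mult i p)
    then obtain s where s: "s \<in> VS.span ?B" "p \<approx> s" by blast
    have anti: "\<exists>c. x * y + y * x \<approx> const c" if "x \<in> set ?xs" "y \<in> set ?xs" for x y
      using that gen_anticommute unfolding set_xs by blast
    have square: "\<exists>c. x * x \<approx> const c" if "x \<in> set ?xs" for x
      using that square_of_anticommutator[OF gen_anticommute] unfolding set_xs by blast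
    have "gen i \<in> set ?xs" using gen_mult(1) unfolding set_xs by simp
    then obtain t where t: "t \<in> VS.span ?B" "gen i * s \<approx> t"
      using span_subproducts_closed[OF xs square anti _ s(1)] by blast
    have "gen i * p \<approx> gen i * s" by (rule cong_mult_left[OF _ s(2)]) (simp add: gen_mult(1))
    then have "gen i * p \<approx> t" using t(2) by (rule cong_trans)
    then show ?case using t(1) by blast
  qed
  then show ?thesis using B finite_subproducts by blast
qed

lemma left_ideal_subspace:
  assumes "left_ideal (free_algebra n) L"
  shows "VS.subspace L"
proof -
  note L = ring.left_ideal_facts[OF free_algebra_ring assms]
  show ?thesis
  proof (rule VS.subspaceI)
    show "scl c x \<in> L" if "x \<in> L" for c x using L(4)[of "const c" x] that by simp
  qed (use L(2,3) in auto)
qed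

text \<open>
  An orthogonal basis of \<open>V\<close> consists of anticommuting elements with nonzero scalar squares that
  generate \<open>F\<close> together with the scalars, so the averaged projection onto a left ideal commutes
  with all of \<open>F\<close> modulo \<open>K\<close>, and its kernel is a complementary left ideal.
\<close>

lemma left_ideal_complement:
  assumes nondeg: "\<forall>v. (\<forall>i\<le>n. (\<Sum>j\<le>n. Q i j * v j) = 0) \<longrightarrow> (\<forall>i\<le>n. v i = 0)"
    and L: "left_ideal (free_algebra n) L" "K \<subseteq> L"
  shows "\<exists>C. left_ideal (free_algebra n) C \<and> L \<inter> C = K \<and> (\<forall>x \<in> F. \<exists>a \<in> L. \<exists>b \<in> C. x = a + b)"
proof -
  interpret ring "free_algebra n :: (word \<Rightarrow>\<^sub>0 'k) ring" by (rule free_algebra_ring)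
  note L_closed = left_ideal_facts[OF L(1), simplified]
  have V_nondeg: "x = 0" if x: "x \<in> V" and orth: "\<And>y. y \<in> V \<Longrightarrow> form x y = 0" for x
  proof (rule V_lookup_zero[OF x])
    have "(\<Sum>j\<le>n. Q i j * Poly_Mapping.lookup x (Word [j])) = 0" if "i \<le> n" for i
      using orth[OF VS.span_base, of "gen i"] that by (simp add: form_gen_right)
    then show "Poly_Mapping.lookup x (Word [i]) = 0" if "i \<le> n" for i
      using nondeg[rule_format, of "\<lambda>i. Poly_Mapping.lookup x (Word [i])" i] that by simp
  qed
  have "\<exists>S. finite S \<and> S \<subseteq> V \<and> (\<forall>x \<in> S. \<forall>y \<in> S. x \<noteq> y \<longrightarrow> form x y = 0) \<and>
      (\<forall>x \<in> S. form x x \<noteq> 0) \<and> V \<subseteq> VS.span S"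
    by (rule VS.exists_orthogonal_spanning_set[OF _ form_add form_scl form_sym V_nondeg two])
      simp_all
  then obtain S where *: "finite S \<and> S \<subseteq> V \<and> (\<forall>x \<in> S. \<forall>y \<in> S. x \<noteq> y \<longrightarrow> form x y = 0) \<and>
      (\<forall>x \<in> S. form x x \<noteq> 0) \<and> V \<subseteq> VS.span S" ..
  then have S: "finite S" "S \<subseteq> V" "V \<subseteq> VS.span S"
    and S_orth: "\<And>x y. x \<in> S \<Longrightarrow> y \<in> S \<Longrightarrow> x \<noteq> y \<Longrightarrow> form x y = 0"
    and S_anisotropic: "\<And>x. x \<in> S \<Longrightarrow> form x x \<noteq> 0"
    by simp_all
  have SF: "S \<subseteq> F" using S(2) V_subset by blast
  have "\<exists>P. Vector_Spaces.linear scl scl P \<and> range P \<subseteq> L \<and> (\<forall>y \<in> L. P y \<approx> y) \<and>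
      (\<forall>x \<in> S. \<forall>y \<in> F. P (x * y) \<approx> x * P y)"
  proof (rule equivariant_projection[OF two L S(1) SF])
    show "\<exists>q. q \<noteq> 0 \<and> x * x \<approx> const q" if "x \<in> S" for x
      using square_of_anticommutator[OF anticommutator_form] S(2) S_anisotropic that by blast
    show "x * y + y * x \<approx> 0" if "x \<in> S" "y \<in> S" "x \<noteq> y" for x y
      using anticommutator_form[of x y] S(2) S_orth[OF that] that by (auto simp: const_conv_scl)
  qed
  then obtain P where P: "Vector_Spaces.linear scl scl P" "range P \<subseteq> L" "\<And>y. y \<in> L \<Longrightarrow> P y \<approx> y"
      "\<And>x y. x \<in> S \<Longrightarrow> y \<in> F \<Longrightarrow> P (x * y) \<approx> x * P y"
    by blast
  interpret P: Vector_Spaces.linear scl scl P by (rule P(1))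
  have PL: "P y \<in> L" for y using P(2) by blast
  have P_span: "P (x * y) \<approx> x * P y" if "x \<in> VS.span S" "y \<in> F" for x y
  proof -
    have "VS.subspace {x. P (x * y) \<approx> x * P y}"
      by (rule VS.subspaceI) (auto simp: distrib_right P.add P.scale intro: cong_add cong_scl)
    then show ?thesis using VS.span_induct[OF that(1)] P(4) that(2) by blast
  qed
  have P_gen: "P (gen i * y) \<approx> gen i * P y" if "i \<le> n" "y \<in> F" for i y
    by (rule P_span) (use that S(3) VS.span_base[of "gen i" "gen ` {..n}"] in auto)
  have P_mult: "P (a * y) \<approx> a * P y" if "a \<in> F" "y \<in> F" for a y
    using that
  proof (induction a rule: free_algebra_induct)
    case (const c)
    show ?case by (simp add: P.scale)
  next
    case (add p q)
    then show ?case by (simp add: distrib_right P.add cong_add)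
  next
    case (gen_mult i p)
    have "P (gen i * (p * y)) \<approx> gen i * P (p * y)"
      by (rule P_gen) (use gen_mult in auto)
    also have "\<dots> \<approx> gen i * (p * P y)"
      by (rule cong_mult_left) (use gen_mult in auto)
    finally show ?case by (simp add: mult.assoc)
  qed
  define C where "C = {y \<in> F. P y \<in> K}"
  have P_K: "P y \<in> K \<longleftrightarrow> y \<in> K" if "y \<in> L" for y
    using P(3)[OF that] cong_trans cong_sym cong_zero_iff by blast
  have "left_ideal (free_algebra n) C"
  proof (rule left_idealI)
    show "a \<otimes>\<^bsub>free_algebra n\<^esub> y \<in> C" if "a \<in> F" "y \<in> C" for a y
    proof -
      have "a * P y \<in> K" using that K_mult_left by (auto simp: C_def)
      moreover have "P (a * y) \<approx> a * P y" using that P_mult by (auto simp: C_def)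
      ultimately have "P (a * y) \<in> K" using cong_trans cong_zero_iff by blast
      then show ?thesis using that by (simp add: C_def)
    qed
  qed (auto simp: C_def P.add P.zero K_zero K_add)
  moreover have "L \<inter> C = K"
    using P_K L(2) K_subset by (auto simp: C_def)
  moreover have "\<exists>a \<in> L. \<exists>b \<in> C. x = a + b" if "x \<in> F" for x
  proof (intro bexI)
    show "x = P x + (x - P x)" by simp
    have "P (P x) - P x \<in> K" using P(3)[OF PL] by (simp add: cong_def)
    then have "P (x - P x) \<in> K" using K_uminus[of "P (P x) - P x"] by (simp add: P.diff)
    moreover have "P x \<in> F" using PL L_closed(1) by blast
    ultimately show "x - P x \<in> C" using that by (simp add: C_def)
  qed (rule PL)
  ultimately show ?thesis by blast
qed

lemma nondegenerate_imp_semisimple: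
  assumes nondeg: "\<forall>v. (\<forall>i\<le>n. (\<Sum>j\<le>n. Q i j * v j) = 0) \<longrightarrow> (\<forall>i\<le>n. v i = 0)"
  shows "semisimple_ring (free_algebra n Quot K)"
proof -
  obtain B where B: "finite B" "B \<subseteq> F" "\<And>p. p \<in> F \<Longrightarrow> \<exists>s \<in> VS.span B. p \<approx> s"
    using finite_dimensional_mod_K by blast
  show ?thesis
  proof (rule ideal.semisimple_quotientI[OF ideal, where d = "\<lambda>L. VS.dim (L \<inter> VS.span B)"])
    fix L assume "left_ideal (free_algebra n) L" "K \<subseteq> L"
    then show "\<exists>C. left_ideal (free_algebra n) C \<and> L \<inter> C = K \<and>
        (\<forall>x \<in> F. \<exists>a \<in> L. \<exists>b \<in> C. x = a \<oplus>\<^bsub>free_algebra n\<^esub> b)"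
      using left_ideal_complement[OF nondeg, of L] by auto
  next
    fix L M
    assume L: "left_ideal (free_algebra n) L" and M: "left_ideal (free_algebra n) M"
      and KL: "K \<subseteq> L" and LM: "L \<subset> M"
    obtain x where x: "x \<in> M" "x \<notin> L" using LM by blast
    have "x \<in> F" using x(1) ring.left_ideal_subset[OF free_algebra_ring M] by blast
    then obtain s where s: "s \<in> VS.span B" "x - s \<in> K" using B(3) cong_def by blast
    have "x - s \<in> L" "x - s \<in> M" using s(2) KL LM by auto
    then have "s \<in> M" "s \<notin> L"
      using VS.subspace_diff[OF left_ideal_subspace[OF M] x(1), of "x - s"]
        VS.subspace_add[OF left_ideal_subspace[OF L], of "x - s" s] x(2) by auto
    then have "L \<inter> VS.span B \<subset> M \<inter> VS.span B" using LM s(1) by blast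
    then show "VS.dim (L \<inter> VS.span B) < VS.dim (M \<inter> VS.span B)"
      by (intro VS.dim_strict_mono[OF B(1)] VS.subspace_inter left_ideal_subspace[OF L]
          VS.subspace_span) auto
  qed
qed

text \<open>
  A vector \<open>x\<close> in the radical of the form squares to zero and anticommutes with all generators, so
  it generates a nilpotent ideal.
\<close>

lemma semisimple_imp_radical_in_K:
  assumes ss: "semisimple_ring (free_algebra n Quot K)"
    and v: "\<And>i. i \<le> n \<Longrightarrow> (\<Sum>j\<le>n. Q i j * v j) = 0"
  shows "(\<Sum>j\<le>n. scl (v j) (gen j)) \<in> K"
proof -
  interpret ring "free_algebra n :: (word \<Rightarrow>\<^sub>0 'k) ring" by (rule free_algebra_ring)
  define x where "x = (\<Sum>j\<le>n. scl (v j) (gen j))"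
  have xV: "x \<in> V" unfolding x_def by (intro VS.span_sum VS.span_scale VS.span_base) auto
  then have xF: "x \<in> F" using V_subset by blast
  have lookup_x: "Poly_Mapping.lookup x (Word [j]) = v j" if "j \<le> n" for j
  proof -
    have "Poly_Mapping.lookup x (Word [j]) = (\<Sum>i\<le>n. if i = j then v j else 0)"
      unfolding x_def lookup_sum by (rule sum.cong) (auto simp: lookup_scl lookup_gen)
    then show ?thesis using that by simp
  qed
  have form_gen: "form x (gen i) = 0" if "i \<le> n" for i
    using v[OF that] by (simp add: form_gen_right[OF that] lookup_x)
  have "form x x = (\<Sum>i\<le>n. Poly_Mapping.lookup x (Word [i]) * form x (gen i))"
    by (simp add: form_gen_right) (simp add: form_def sum_distrib_left mult.assoc)
  then have "form x x = 0" by (simp add: form_gen)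
  then have "x * x \<in> K"
    using square_of_anticommutator[OF anticommutator_form[OF xV xV]]
    by (simp add: const_conv_scl cong_zero_iff)
  moreover have "\<exists>a' \<in> F. x * a \<approx> a' * x" if "a \<in> F" for a
    using that
  proof (induction a rule: free_algebra_induct)
    case (const c)
    show ?case by (intro bexI[of _ "const c"]) simp_all
  next
    case (add p q)
    then obtain p' q' where "p' \<in> F" "q' \<in> F" "x * p \<approx> p' * x" "x * q \<approx> q' * x" by blast
    then show ?case
      by (intro bexI[of _ "p' + q'"]) (simp_all add: algebra_simps cong_add)
  next
    case (gen_mult i p)
    then obtain p' where p': "p' \<in> F" "x * p \<approx> p' * x" by blast
    have "gen i \<in> V" using gen_mult(1) by (intro VS.span_base) auto
    then have anti: "x * gen i + gen i * x \<approx> 0"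
      using anticommutator_form[OF xV, of "gen i"] form_gen[OF gen_mult(1)]
      by (simp add: const_conv_scl)
    have "x * (gen i * p) = (x * gen i + gen i * x) * p - gen i * (x * p)"
      by (simp add: algebra_simps)
    also have "\<dots> \<approx> 0 * p - gen i * (p' * x)"
      by (intro cong_diff cong_mult_right cong_mult_left anti p') (use gen_mult in auto)
    also have "\<dots> = - (gen i * p') * x" by (simp add: mult.assoc)
    finally show ?case using gen_mult(1) p'(1) by (intro bexI[of _ "- (gen i * p')"]) simp_all
  qed
  ultimately have "x \<in> K"
    using ideal.semisimple_quotient_imp_no_square_zero[OF ideal ss, of x] xF
    by (fastforce simp: cong_def free_algebra_minus)
  then show ?thesis by (simp add: x_def)
qed

end

section \<open>The Clifford algebra\<close>

text \<open>
  The entries of \<open>clifford_matrix\<close> as a total function, so that symmetry holds for all indices.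
\<close>

definition clifford_form ::
  "'k \<Rightarrow> (nat \<Rightarrow> 'k) \<Rightarrow> (nat \<Rightarrow> 'k) \<Rightarrow> (nat \<Rightarrow> nat \<Rightarrow> 'k) \<Rightarrow> nat \<Rightarrow> nat \<Rightarrow> 'k::field"
where
  "clifford_form \<alpha> \<beta> \<gamma> lam i j =
    (if i = 0 \<and> j = 0 then \<alpha>
     else if i = 0 then \<gamma> j / 2
     else if j = 0 then \<gamma> i / 2
     else if i = j then \<beta> i
     else if i < j then lam i j / 2
     else lam j i / 2)"

lemma clifford_form_sym: "clifford_form \<alpha> \<beta> \<gamma> lam i j = clifford_form \<alpha> \<beta> \<gamma> lam j i"
  by (auto simp: clifford_form_def)

lemma clifford_matrix_conv_form:
  "clifford_matrix n \<alpha> \<beta> \<gamma> lam = mat (n + 1) (n + 1) (\<lambda>(i, j). clifford_form \<alpha> \<beta> \<gamma> lam i j)"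
  by (simp add: clifford_matrix_def clifford_form_def)

lemma det_clifford_matrix_nonzero_iff:
  "det (clifford_matrix n \<alpha> \<beta> \<gamma> lam) \<noteq> 0 \<longleftrightarrow>
    (\<forall>v. (\<forall>i\<le>n. (\<Sum>j\<le>n. clifford_form \<alpha> \<beta> \<gamma> lam i j * v j) = 0) \<longrightarrow> (\<forall>i\<le>n. v i = 0))"
proof -
  let ?M = "clifford_matrix n \<alpha> \<beta> \<gamma> lam" and ?Q = "clifford_form \<alpha> \<beta> \<gamma> lam"
  have M: "?M \<in> carrier_mat (n + 1) (n + 1)" by (simp add: clifford_matrix_conv_form)
  have mult: "(?M *\<^sub>v v) $ i = (\<Sum>j\<le>n. ?Q i j * v $ j)"
    if "v \<in> carrier_vec (n + 1)" "i \<le> n" for v i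
    using that
    by (simp add: clifford_matrix_conv_form scalar_prod_def atLeast0LessThan lessThan_Suc_atMost)
  have kernel: "?M *\<^sub>v v = 0\<^sub>v (n + 1) \<longleftrightarrow> (\<forall>i\<le>n. (\<Sum>j\<le>n. ?Q i j * v $ j) = 0)"
    if v: "v \<in> carrier_vec (n + 1)" for v
  proof -
    have "?M *\<^sub>v v = 0\<^sub>v (n + 1) \<longleftrightarrow> (\<forall>i<n + 1. (?M *\<^sub>v v) $ i = 0)"
      using M by (auto simp: vec_eq_iff)
    then show ?thesis using mult[OF v] by (simp add: less_Suc_eq_le)
  qed
  have zero: "v = 0\<^sub>v (n + 1) \<longleftrightarrow> (\<forall>i\<le>n. v $ i = 0)" if "v \<in> carrier_vec (n + 1)" for v :: "'a vec"
    using that by (auto simp: vec_eq_iff less_Suc_eq_le)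
  have "det ?M \<noteq> 0 \<longleftrightarrow> (\<forall>v \<in> carrier_vec (n + 1). ?M *\<^sub>v v = 0\<^sub>v (n + 1) \<longrightarrow> v = 0\<^sub>v (n + 1))"
    using det_0_iff_vec_prod_zero_field[OF M] by blast
  also have "\<dots> \<longleftrightarrow> (\<forall>v \<in> carrier_vec (n + 1).
      (\<forall>i\<le>n. (\<Sum>j\<le>n. ?Q i j * v $ j) = 0) \<longrightarrow> (\<forall>i\<le>n. v $ i = 0))"
    using kernel zero by blast
  also have "\<dots> \<longleftrightarrow> (\<forall>v. (\<forall>i\<le>n. (\<Sum>j\<le>n. ?Q i j * v j) = 0) \<longrightarrow> (\<forall>i\<le>n. v i = 0))"
  proof
    assume *: "\<forall>v \<in> carrier_vec (n + 1).
      (\<forall>i\<le>n. (\<Sum>j\<le>n. ?Q i j * v $ j) = 0) \<longrightarrow> (\<forall>i\<le>n. v $ i = 0)"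
    show "\<forall>v. (\<forall>i\<le>n. (\<Sum>j\<le>n. ?Q i j * v j) = 0) \<longrightarrow> (\<forall>i\<le>n. v i = 0)"
    proof
      fix v
      show "(\<forall>i\<le>n. (\<Sum>j\<le>n. ?Q i j * v j) = 0) \<longrightarrow> (\<forall>i\<le>n. v i = 0)"
        using *[rule_format, of "vec (n + 1) v"] by simp
    qed
  qed blast
  finally show ?thesis .
qed

lemma (in free_algebra_ideal) clifford_relations_subset_iff:
  assumes two: "(2 :: 'k) \<noteq> 0"
  shows "clifford_relations n \<alpha> \<beta> \<gamma> lam \<subseteq> K \<longleftrightarrow>
    (\<forall>i\<le>n. \<forall>j\<le>n. gen i * gen j + gen j * gen i \<approx> const (2 * clifford_form \<alpha> \<beta> \<gamma> lam i j))"
    (is "_ \<longleftrightarrow> (\<forall>i\<le>n. \<forall>j\<le>n. ?A i j)")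
proof -
  have "clifford_relations n \<alpha> \<beta> \<gamma> lam \<subseteq> K \<longleftrightarrow>
      gen 0 * gen 0 \<approx> const \<alpha> \<and>
      (\<forall>i \<in> {1..n}. gen i * gen i \<approx> const (\<beta> i)) \<and>
      (\<forall>i \<in> {1..n}. gen 0 * gen i + gen i * gen 0 \<approx> const (\<gamma> i)) \<and>
      (\<forall>i j. 1 \<le> i \<and> i < j \<and> j \<le> n \<longrightarrow> gen i * gen j + gen j * gen i \<approx> const (lam i j))"
    unfolding clifford_relations_def cong_def by blast
  also have "\<dots> \<longleftrightarrow> ?A 0 0 \<and> (\<forall>i \<in> {1..n}. ?A i i) \<and> (\<forall>i \<in> {1..n}. ?A 0 i) \<and>
      (\<forall>i j. 1 \<le> i \<and> i < j \<and> j \<le> n \<longrightarrow> ?A i j)"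
  proof -
    have Q: "2 * clifford_form \<alpha> \<beta> \<gamma> lam 0 0 = 2 * \<alpha>"
      "i \<in> {1..n} \<Longrightarrow> 2 * clifford_form \<alpha> \<beta> \<gamma> lam i i = 2 * \<beta> i"
      "i \<in> {1..n} \<Longrightarrow> 2 * clifford_form \<alpha> \<beta> \<gamma> lam 0 i = \<gamma> i"
      "1 \<le> i \<and> i < j \<and> j \<le> n \<Longrightarrow> 2 * clifford_form \<alpha> \<beta> \<gamma> lam i j = lam i j" for i j
      using two by (simp_all add: clifford_form_def)
    show ?thesis
      unfolding square_cong_const_iff[OF two] by (simp only: Q cong: ball_cong imp_cong)
  qed
  also have "\<dots> \<longleftrightarrow> (\<forall>i\<le>n. \<forall>j\<le>n. ?A i j)"
  proof
    assume *: "?A 0 0 \<and> (\<forall>i \<in> {1..n}. ?A i i) \<and> (\<forall>i \<in> {1..n}. ?A 0 i) \<and>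
      (\<forall>i j. 1 \<le> i \<and> i < j \<and> j \<le> n \<longrightarrow> ?A i j)"
    have le: "?A i j" if ij: "i \<le> j" "j \<le> n" for i j
    proof -
      consider "i = 0" "j = 0" | "i = 0" "j \<in> {1..n}" | "i = j" "i \<in> {1..n}"
        | "1 \<le> i" "i < j" "j \<le> n"
        using ij by (cases "i = 0"; cases "j = 0"; cases "i = j") auto
      then show ?thesis using * by cases simp_all
    qed
    have "?A i j \<longleftrightarrow> ?A j i" for i j by (simp add: add.commute clifford_form_sym)
    then show "\<forall>i\<le>n. \<forall>j\<le>n. ?A i j" using le by (metis nat_le_linear)
  qed auto
  finally show ?thesis .
qed

theorem corollary3p4:
  fixes n :: nat
    and \<alpha> :: "'k::field"
    and \<beta> \<gamma> :: "nat \<Rightarrow> 'k"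
    and lam :: "nat \<Rightarrow> nat \<Rightarrow> 'k"
  assumes "CHAR('k) \<noteq> 2"
  shows "semisimple_ring (clifford_algebra n \<alpha> \<beta> \<gamma> lam) \<longleftrightarrow>
         det (clifford_matrix n \<alpha> \<beta> \<gamma> lam) \<noteq> 0"
proof -
  let ?F = "free_algebra n :: (word \<Rightarrow>\<^sub>0 'k) ring"
  let ?R = "clifford_relations n \<alpha> \<beta> \<gamma> lam" and ?Q = "clifford_form \<alpha> \<beta> \<gamma> lam"
  let ?K = "genideal ?F ?R"
  interpret F: ring ?F by (rule free_algebra_ring)
  have two: "(2 :: 'k) \<noteq> 0"
  proof
    assume "(2 :: 'k) = 0"
    then have "CHAR('k) dvd 2" using of_nat_eq_0_iff_char_dvd[of 2, where ?'a = 'k] by simp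
    then show False using assms CHAR_not_1'[where ?'a = 'k] dvd_imp_le[of "CHAR('k)" 2]
      by (cases "CHAR('k)") (auto simp: le_Suc_eq numeral_2_eq_2)
  qed
  interpret K: free_algebra_ideal n ?K
    by (rule free_algebra_ideal.intro) (rule F.genideal_ideal[OF clifford_relations_subset])
  have anti: "K.cong (gen i * gen j + gen j * gen i) (const (2 * ?Q i j))" if "i \<le> n" "j \<le> n" for i j
    using K.clifford_relations_subset_iff[OF two] F.genideal_self[OF clifford_relations_subset] that
    by blast
  interpret K: clifford_ideal n ?K ?Q
    by standard (rule two, rule clifford_form_sym, rule anti)
  have A: "clifford_algebra n \<alpha> \<beta> \<gamma> lam = ?F Quot ?K" by (simp add: clifford_algebra_def)
  show ?thesis
  proof
    assume "det (clifford_matrix n \<alpha> \<beta> \<gamma> lam) \<noteq> 0"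
    then show "semisimple_ring (clifford_algebra n \<alpha> \<beta> \<gamma> lam)"
      unfolding A det_clifford_matrix_nonzero_iff by (rule K.nondegenerate_imp_semisimple)
  next
    assume ss: "semisimple_ring (clifford_algebra n \<alpha> \<beta> \<gamma> lam)"
    interpret N: free_algebra_ideal n "rep_kernel n ?Q"
      by (rule free_algebra_ideal.intro) (rule rep_kernel_ideal)
    have "N.cong (gen i * gen j + gen j * gen i) (const (2 * ?Q i j))" if "i \<le> n" "j \<le> n" for i j
      using gen_anticommutator_in_rep_kernel[OF that, of ?Q] clifford_form_sym[of \<alpha> \<beta> \<gamma> lam j i]
      unfolding N.cong_def mult_2 by simp
    then have "?R \<subseteq> rep_kernel n ?Q" using N.clifford_relations_subset_iff[OF two] by blast
    then have K_kernel: "?K \<subseteq> rep_kernel n ?Q" by (rule F.genideal_minimal[OF rep_kernel_ideal])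
    show "det (clifford_matrix n \<alpha> \<beta> \<gamma> lam) \<noteq> 0"
      unfolding det_clifford_matrix_nonzero_iff
    proof (intro allI impI)
      fix v i
      assume "\<forall>i\<le>n. (\<Sum>j\<le>n. ?Q i j * v j) = 0" and i: "i \<le> n"
      then have "(\<Sum>j\<le>n. scl (v j) (gen j)) \<in> ?K"
        by (intro K.semisimple_imp_radical_in_K ss[unfolded A]) blast
      then show "v i = 0" using independent_gens_mod_rep_kernel[OF _ i] K_kernel by blast
    qed
  qed
qed

end
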